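(* In the setting described in the context, suppose the problem is in Case 1 or in Case 2, with the corresponding cones $\mathcal{C}[x]$ and $\mathcal{C}[y]$, and assume (A2). Let $r^{\mathrm{primal}}$, $r^{\mathrm{dual}}$ be the optimal values of the conic problems (P) and (D). Then: (i) A minimizer of (D) always exists, $r^{\mathrm{dual}}=r^{\star}$, and for every minimizer $\mathscr{L}^{\star}$ of (D), $\frac{\mathscr{L}^{\star}(x)}{\mathscr{L}^{\star}(1)}\in\mathbf{S}$. (ii) If (A3) holds, then $r^{\mathrm{primal}}=r^{\star}$ and it is attained.
   Context: Let $x=(x_1,\dots,x_m)$, $y=(y_1,\dots,y_n)$, $f,g,\psi_1,\dots,\psi_s\in\mathbb{R}[x]$, $p\in\mathbb{R}[x,y]$, $\mathbf{Y}\subset\mathbb{R}^n$ compact. Let $\mathbf{K}:=\{x\in\mathbb{R}^m:\psi_1(x)\le 0,\dots,\psi_s(x)\le 0,\ p(x,y)\le 0\ \forall y\in\mathbf{Y}\}$, $r^{\star}:=\min_{x\in\mathbf{K}} f(x)/g(x)$, and let $\mathbf{S}$ be the set of minimizers of $f/g$ on $\mathbf{K}$. It is assumed throughout that $\mathbf{S}\neq\emptyset$. $\mathbf{d}:=\max\{\deg f,\deg g,\deg\psi_1,\dots,\deg\psi_s,\deg_x p(x,y)\}$, $d_y:=\deg_y p(x,y)$. $\Sigma^2[x]$, $\Sigma^2[y]$ denote sums of squares of polynomials, and $\mathbb{R}[x]_k$ the polynomials of degree at most $k$. A polynomial $h\in\mathbb{R}[x]$ is s.o.s-convex if $\nabla^2h(x)=H(x)^TH(x)$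 for some integer $r$ and some matrix polynomial $H\in\mathbb{R}[x]^{r\times m}$. (A2): Either $f(x)\ge 0$ and $g(x)>0$ for all $x\in\mathbf{K}$; or $g$ is affine and $g(x)>0$ for all $x\in\mathbf{K}$. (A3): There exist a finite nonnegative Borel measure $\mu^{\star}$ supported on $\mathbf{Y}$ and $\eta^{\star}\in\mathbb{R}_+^s$ such that $\inf_{x\in\mathbb{R}^m}\{f(x)-r^{\star}g(x)+\int_{\mathbf{Y}}p(x,y)\,d\mu^{\star}(y)+\sum_{j=1}^s\eta_j^{\star}\psi_j(x)\}=0$. Case 1: $n=1$, $\mathbf{Y}=[-1,1]$, and $f$, $-g$, $\psi_1,\dots,\psi_s$ and $p(\cdot,y)$ for every $y\in\mathbf{Y}$ are all s.o.s-convex in $x$. In this case $\mathcal{C}[x]=\Sigma^2[x]\cap\mathbb{R}[x]_{2\mathbf{d}}$ and $$\mathcal{C}[y]=\{\theta_0+\theta_1(1-y_1^2):\theta_0,\theta_1\in\Sigma^2[y_1],\ \deg\theta_0\le 2\lceil d_y/2\rceil,\ \deg(\theta_1(1-y_1^2))\le 2\lceil d_y/2\rceil\}.$$ Case 2: $n>1$, $\mathbf{Y}=\{y\in\mathbb{R}^n:\phi(y)\ge 0\}$ with $\deg\phi=2$ and $\phi(\bar y)>0$ for some $\bar y\in\mathbb{R}^n$; $\deg_y p(x,y)=2$; and $f$, $-g$, $\psi_1,\dots,\psi_s$ and $p(\cdot,y)$ for every $y\in\mathbf{Y}$ are all s.o.s-convex in $x$. In this case $\mathcal{C}[x]=\Sigma^2[x]\cap\mathbb{R}[x]_{2\mathbf{d}}$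 and $$\mathcal{C}[y]=\{\theta+\lambda\phi:\lambda\ge 0,\ \theta\in\Sigma^2[y],\ \deg\theta\le 2\}.$$ For a convex cone $C$ of polynomials, $C^*$ denotes the set of linear functionals that are nonnegative on $C$ (for $C=\Sigma^2[x]\cap\mathbb{R}[x]_{2\mathbf{d}}$ these may be regarded as functionals on $\mathbb{R}[x]_{2\mathbf{d}}$). For a linear functional $\mathscr{L}$ in $x$ (resp. $\mathscr{H}$ in $y$), $\mathscr{L}(p(x,y))\in\mathbb{R}[y]$ (resp. $\mathscr{H}(p(x,y))\in\mathbb{R}[x]$) is obtained by applying the functional to $p$ regarded as a polynomial in $x$ with coefficients in $\mathbb{R}[y]$ (resp. in $y$ with coefficients in $\mathbb{R}[x]$). Write $\mathscr{L}(x):=(\mathscr{L}(x_1),\dots,\mathscr{L}(x_m))$. The conic problems are $$\text{(P)}\quad r^{\mathrm{primal}}:=\sup_{\rho,\mathscr{H},\eta}\Big\{\rho: f(x)-\rho g(x)+\mathscr{H}(p(x,y))+\sum_{j=1}^s\eta_j\psi_j(x)\in\mathcal{C}[x],\ \rho\in\mathbb{R},\ \mathscr{H}\in(\mathcal{C}[y])^*,\ \eta\in\mathbb{R}_+^s\Big\},$$ $$\text{(D)}\quad r^{\mathrm{dual}}:=\inf_{\mathscr{L}}\Big\{\mathscr{L}(f): \mathscr{L}\in(\mathcal{C}[x])^*,\ \mathscr{L}(g)=1,\ -\mathscr{L}(p(x,y))\in\mathcal{C}[y],\ \mathscr{L}(\psi_j)\le 0,\ j=1,\dots,s\Big\}.$$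 *)

theory Defs
  imports "HOL-Analysis.Analysis" "HOL-Analysis.Finite_Function_Topology"
begin

section \<open>Real polynomials in finitely many variables\<close>

text \<open>\<open>\<real>[x]\<close> is the monoid algebra of finitely supported coefficient functions on exponent
  vectors, with the ring and real vector space structure of \<open>poly_mapping\<close>.
  The index type \<open>'v\<close> of the variables is finite, and points are elements of \<open>real ^ 'v\<close>.\<close>

type_synonym 'v mpoly = "('v \<Rightarrow>\<^sub>0 nat) \<Rightarrow>\<^sub>0 real"

text \<open>\<open>\<real>[x, y]\<close>: the key \<open>(\<alpha>, \<beta>)\<close> stands for the monomial \<open>x\<^sup>\<alpha> y\<^sup>\<beta>\<close>.\<close>

type_synonym ('m, 'n) mpoly2 = "(('m \<Rightarrow>\<^sub>0 nat) \<times> ('n \<Rightarrow>\<^sub>0 nat)) \<Rightarrow>\<^sub>0 real"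

definition monomial :: "('v \<Rightarrow>\<^sub>0 nat) \<Rightarrow> 'v mpoly" where
  "monomial \<alpha> = Poly_Mapping.single \<alpha> 1"

definition variable :: "'v \<Rightarrow> 'v mpoly" where
  "variable i = monomial (Poly_Mapping.single i 1)"

definition monomial_degree :: "('v::finite \<Rightarrow>\<^sub>0 nat) \<Rightarrow> nat" where
  "monomial_degree \<alpha> = (\<Sum>i\<in>UNIV. Poly_Mapping.lookup \<alpha> i)"

text \<open>Total degrees; the zero polynomial has degree 0.\<close>

definition deg :: "'v::finite mpoly \<Rightarrow> nat" where
  "deg h = Max (insert 0 (monomial_degree ` Poly_Mapping.keys h))"

definition deg_x :: "('m::finite, 'n::finite) mpoly2 \<Rightarrow> nat" where
  "deg_x p = Max (insert 0 ((\<lambda>(\<alpha>, \<beta>). monomial_degree \<alpha>) ` Poly_Mapping.keys p))"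

definition deg_y :: "('m::finite, 'n::finite) mpoly2 \<Rightarrow> nat" where
  "deg_y p = Max (insert 0 ((\<lambda>(\<alpha>, \<beta>). monomial_degree \<beta>) ` Poly_Mapping.keys p))"

definition eval :: "'v::finite mpoly \<Rightarrow> real ^ 'v \<Rightarrow> real" where
  "eval h x = (\<Sum>\<alpha>\<in>Poly_Mapping.keys h.
     Poly_Mapping.lookup h \<alpha> * (\<Prod>i\<in>UNIV. (x $ i) ^ Poly_Mapping.lookup \<alpha> i))"

text \<open>Formal partial derivative. The subtraction of exponents is truncated, but where it truncates
  the coefficient vanishes.\<close>

definition partial_deriv :: "'v \<Rightarrow> 'v mpoly \<Rightarrow> 'v mpoly" where
  "partial_deriv i h = (\<Sum>\<alpha>\<in>Poly_Mapping.keys h.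
     Poly_Mapping.single (\<alpha> - Poly_Mapping.single i 1)
       (real (Poly_Mapping.lookup \<alpha> i) * Poly_Mapping.lookup h \<alpha>))"

text \<open>\<open>\<L>(p(x, y)) \<in> \<real>[y]\<close> and \<open>\<H>(p(x, y)) \<in> \<real>[x]\<close> for linear functionals \<open>\<L>\<close> on \<open>\<real>[x]\<close> and
  \<open>\<H>\<close> on \<open>\<real>[y]\<close>.\<close>

definition apply_x :: "('m mpoly \<Rightarrow> real) \<Rightarrow> ('m, 'n) mpoly2 \<Rightarrow> 'n mpoly" where
  "apply_x L p = (\<Sum>(\<alpha>, \<beta>)\<in>Poly_Mapping.keys p.
     Poly_Mapping.single \<beta> (Poly_Mapping.lookup p (\<alpha>, \<beta>) * L (monomial \<alpha>)))"

definition apply_y :: "('n mpoly \<Rightarrow> real) \<Rightarrow> ('m, 'n) mpoly2 \<Rightarrow> 'm mpoly" where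
  "apply_y H p = (\<Sum>(\<alpha>, \<beta>)\<in>Poly_Mapping.keys p.
     Poly_Mapping.single \<alpha> (Poly_Mapping.lookup p (\<alpha>, \<beta>) * H (monomial \<beta>)))"

text \<open>The polynomial \<open>p(\<cdot>, y)\<close> for a fixed point \<open>y\<close>: here the functional is evaluation at \<open>y\<close>.\<close>

definition at_y :: "('m, 'n::finite) mpoly2 \<Rightarrow> real ^ 'n \<Rightarrow> 'm mpoly" where
  "at_y p y = apply_y (\<lambda>q. eval q y) p"


section \<open>Sums of squares, s.o.s-convexity and cones\<close>

definition sos :: "'v mpoly set" where
  "sos = {h. \<exists>(r::nat) q. h = (\<Sum>k<r. q k ^ 2)}"

text \<open>\<open>\<nabla>\<^sup>2h = H\<^sup>T H\<close>, where \<open>H\<close> has rows \<open>k < r\<close> and columns indexed by the variables.\<close>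

definition sos_convex :: "'v mpoly \<Rightarrow> bool" where
  "sos_convex h \<longleftrightarrow> (\<exists>(r::nat) (H :: nat \<Rightarrow> 'v \<Rightarrow> 'v mpoly).
     \<forall>i j. partial_deriv i (partial_deriv j h) = (\<Sum>k<r. H k i * H k j))"

definition affine_poly :: "'v::finite mpoly \<Rightarrow> bool" where
  "affine_poly h \<longleftrightarrow> deg h \<le> 1"

text \<open>Functionals are defined on all polynomials; every functional on a subspace such as
  \<open>\<real>[x]\<^sub>2\<^sub>d\<close> is the restriction of such a functional.\<close>

definition dual_cone :: "'v mpoly set \<Rightarrow> ('v mpoly \<Rightarrow> real) set" where
  "dual_cone C = {L. linear L \<and> (\<forall>h\<in>C. 0 \<le> L h)}"

definition max_deg ::
  "'m::finite mpoly \<Rightarrow> 'm mpoly \<Rightarrow> nat \<Rightarrow> (nat \<Rightarrow> 'm mpoly) \<Rightarrow> ('m, 'n::finite) mpoly2 \<Rightarrow> nat"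
where
  "max_deg f g s \<psi> p = Max ({deg f, deg g, deg_x p} \<union> (\<lambda>j. deg (\<psi> j)) ` {1..s})"

definition cone_x :: "nat \<Rightarrow> 'm::finite mpoly set" where
  "cone_x d = sos \<inter> {h. deg h \<le> 2 * d}"

text \<open>Used only when the index type \<open>'n\<close> has exactly one element, which \<open>the_elem UNIV\<close> denotes.\<close>

definition cone_y_interval :: "nat \<Rightarrow> 'n::finite mpoly set" where
  "cone_y_interval dy =
     (let w = 1 - variable (the_elem UNIV) ^ 2; N = 2 * nat \<lceil>real dy / 2\<rceil>
      in {\<theta>\<^sub>0 + \<theta>\<^sub>1 * w | \<theta>\<^sub>0 \<theta>\<^sub>1. \<theta>\<^sub>0 \<in> sos \<and> \<theta>\<^sub>1 \<in> sos \<and> deg \<theta>\<^sub>0 \<le> N \<and> deg (\<theta>\<^sub>1 * w) \<le> N})"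

definition cone_y_quadratic :: "'n::finite mpoly \<Rightarrow> 'n mpoly set" where
  "cone_y_quadratic \<phi> = {\<theta> + c *\<^sub>R \<phi> | \<theta> c. 0 \<le> c \<and> \<theta> \<in> sos \<and> deg \<theta> \<le> 2}"


section \<open>The fractional semi-infinite program\<close>

definition feasible_set ::
  "nat \<Rightarrow> (nat \<Rightarrow> 'm::finite mpoly) \<Rightarrow> ('m, 'n::finite) mpoly2 \<Rightarrow> (real ^ 'n) set \<Rightarrow> (real ^ 'm) set"
where
  "feasible_set s \<psi> p Y =
     {x. (\<forall>j\<in>{1..s}. eval (\<psi> j) x \<le> 0) \<and> (\<forall>y\<in>Y. eval (at_y p y) x \<le> 0)}"

definition minimizers ::
  "'m::finite mpoly \<Rightarrow> 'm mpoly \<Rightarrow> (real ^ 'm) set \<Rightarrow> (real ^ 'm) set"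
where
  "minimizers f g K = {x\<in>K. \<forall>z\<in>K. eval f x / eval g x \<le> eval f z / eval g z}"

text \<open>The minimum of \<open>f / g\<close> on \<open>K\<close>; meaningful only if it is attained.\<close>

definition min_value :: "'m::finite mpoly \<Rightarrow> 'm mpoly \<Rightarrow> (real ^ 'm) set \<Rightarrow> real" where
  "min_value f g K = (LEAST r. r \<in> (\<lambda>x. eval f x / eval g x) ` K)"

definition A2 :: "'m::finite mpoly \<Rightarrow> 'm mpoly \<Rightarrow> (real ^ 'm) set \<Rightarrow> bool" where
  "A2 f g K \<longleftrightarrow>
     (\<forall>x\<in>K. 0 \<le> eval f x \<and> 0 < eval g x) \<or>
     (affine_poly g \<and> (\<forall>x\<in>K. 0 < eval g x))"

text \<open>The infimum is taken in the extended reals, so that it is not a junk value on sets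
  unbounded below.\<close>

definition A3 ::
  "'m::finite mpoly \<Rightarrow> 'm mpoly \<Rightarrow> nat \<Rightarrow> (nat \<Rightarrow> 'm mpoly) \<Rightarrow> ('m, 'n::finite) mpoly2
   \<Rightarrow> (real ^ 'n) set \<Rightarrow> real \<Rightarrow> bool"
where
  "A3 f g s \<psi> p Y r \<longleftrightarrow>
     (\<exists>(\<mu> :: (real ^ 'n) measure) (\<eta> :: nat \<Rightarrow> real).
        sets \<mu> = sets borel \<and> finite_measure \<mu> \<and> emeasure \<mu> (- Y) = 0 \<and>
        (\<forall>j\<in>{1..s}. 0 \<le> \<eta> j) \<and>
        (INF x\<in>UNIV. ereal (eval f x - r * eval g x
            + (LINT y:Y|\<mu>. eval (at_y p y) x)
            + (\<Sum>j=1..s. \<eta> j * eval (\<psi> j) x))) = 0)"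

definition all_sos_convex ::
  "'m::finite mpoly \<Rightarrow> 'm mpoly \<Rightarrow> nat \<Rightarrow> (nat \<Rightarrow> 'm mpoly) \<Rightarrow> ('m, 'n::finite) mpoly2
   \<Rightarrow> (real ^ 'n) set \<Rightarrow> bool"
where
  "all_sos_convex f g s \<psi> p Y \<longleftrightarrow>
     sos_convex f \<and> sos_convex (- g) \<and> (\<forall>j\<in>{1..s}. sos_convex (\<psi> j)) \<and>
     (\<forall>y\<in>Y. sos_convex (at_y p y))"

definition case1 ::
  "'m::finite mpoly \<Rightarrow> 'm mpoly \<Rightarrow> nat \<Rightarrow> (nat \<Rightarrow> 'm mpoly) \<Rightarrow> ('m, 'n::finite) mpoly2
   \<Rightarrow> (real ^ 'n) set \<Rightarrow> bool"
where
  "case1 f g s \<psi> p Y \<longleftrightarrow>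
     CARD('n) = 1 \<and> Y = {y. \<forall>i. y $ i \<in> {-1..1}} \<and> all_sos_convex f g s \<psi> p Y"

definition case2 ::
  "'m::finite mpoly \<Rightarrow> 'm mpoly \<Rightarrow> nat \<Rightarrow> (nat \<Rightarrow> 'm mpoly) \<Rightarrow> ('m, 'n::finite) mpoly2
   \<Rightarrow> (real ^ 'n) set \<Rightarrow> 'n mpoly \<Rightarrow> bool"
where
  "case2 f g s \<psi> p Y \<phi> \<longleftrightarrow>
     CARD('n) > 1 \<and> Y = {y. eval \<phi> y \<ge> 0} \<and> deg \<phi> = 2 \<and> (\<exists>y. eval \<phi> y > 0) \<and>
     deg_y p = 2 \<and> all_sos_convex f g s \<psi> p Y"


section \<open>The conic problems\<close>

definition primal_feasible ::
  "'m::finite mpoly \<Rightarrow> 'm mpoly \<Rightarrow> nat \<Rightarrow> (nat \<Rightarrow> 'm mpoly) \<Rightarrow> ('m, 'n::finite) mpoly2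
   \<Rightarrow> 'm mpoly set \<Rightarrow> 'n mpoly set \<Rightarrow> (real \<times> ('n mpoly \<Rightarrow> real) \<times> (nat \<Rightarrow> real)) set"
where
  "primal_feasible f g s \<psi> p Cx Cy = {(\<rho>, H, \<eta>).
     H \<in> dual_cone Cy \<and> (\<forall>j\<in>{1..s}. 0 \<le> \<eta> j) \<and>
     f - \<rho> *\<^sub>R g + apply_y H p + (\<Sum>j=1..s. \<eta> j *\<^sub>R \<psi> j) \<in> Cx}"

definition primal_value ::
  "'m::finite mpoly \<Rightarrow> 'm mpoly \<Rightarrow> nat \<Rightarrow> (nat \<Rightarrow> 'm mpoly) \<Rightarrow> ('m, 'n::finite) mpoly2
   \<Rightarrow> 'm mpoly set \<Rightarrow> 'n mpoly set \<Rightarrow> ereal"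
where
  "primal_value f g s \<psi> p Cx Cy =
     (SUP (\<rho>, H, \<eta>) \<in> primal_feasible f g s \<psi> p Cx Cy. ereal \<rho>)"

definition dual_feasible ::
  "'m::finite mpoly \<Rightarrow> nat \<Rightarrow> (nat \<Rightarrow> 'm mpoly) \<Rightarrow> ('m, 'n::finite) mpoly2
   \<Rightarrow> 'm mpoly set \<Rightarrow> 'n mpoly set \<Rightarrow> ('m mpoly \<Rightarrow> real) set"
where
  "dual_feasible g s \<psi> p Cx Cy =
     {L \<in> dual_cone Cx. L g = 1 \<and> - apply_x L p \<in> Cy \<and> (\<forall>j\<in>{1..s}. L (\<psi> j) \<le> 0)}"

definition dual_value ::
  "'m::finite mpoly \<Rightarrow> 'm mpoly \<Rightarrow> nat \<Rightarrow> (nat \<Rightarrow> 'm mpoly) \<Rightarrow> ('m, 'n::finite) mpoly2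
   \<Rightarrow> 'm mpoly set \<Rightarrow> 'n mpoly set \<Rightarrow> ereal"
where
  "dual_value f g s \<psi> p Cx Cy = (INF L \<in> dual_feasible g s \<psi> p Cx Cy. ereal (L f))"

definition dual_minimizer ::
  "'m::finite mpoly \<Rightarrow> 'm mpoly \<Rightarrow> nat \<Rightarrow> (nat \<Rightarrow> 'm mpoly) \<Rightarrow> ('m, 'n::finite) mpoly2
   \<Rightarrow> 'm mpoly set \<Rightarrow> 'n mpoly set \<Rightarrow> ('m mpoly \<Rightarrow> real) \<Rightarrow> bool"
where
  "dual_minimizer f g s \<psi> p Cx Cy L \<longleftrightarrow>
     L \<in> dual_feasible g s \<psi> p Cx Cy \<and>
     (\<forall>L' \<in> dual_feasible g s \<psi> p Cx Cy. L f \<le> L' f)"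

end

theory Submission
  imports Defs
begin

text \<open>For an s.o.s-convex \<open>h\<close> the remainder \<open>h(x) - h(a) - \<nabla>h(a)(x - a)\<close> is a sum of squares of degree at most
  \<open>deg h\<close>, which gives Jensen's inequality \<open>\<L>(1) h(\<L>(x) / \<L>(1)) \<le> \<L>(h)\<close> for dual feasible \<open>\<L>\<close>. So
  \<open>\<L>(x) / \<L>(1)\<close> is feasible and, by (A2), its objective value is at most \<open>\<L>(f)\<close>. Conversely, a minimizer
  \<open>x\<close> yields the dual feasible functional \<open>h \<mapsto> h(x) / g(x)\<close>, because \<open>\<C>[y]\<close> contains all polynomials of the
  relevant degree that are nonnegative on \<open>Y\<close> (Lukacs's theorem in Case 1, the S-lemma for an ellipsoid
  in Case 2).

  Under (A3) the Lagrangian is minimal, with value 0, at the minimizer, so its gradient vanishes there.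
  By compactness of convex hulls in \<open>\<real>\<^sup>m\<close> the measure can be replaced by finitely many atoms at active
  constraints without changing this gradient; the resulting Lagrangian is a finite nonnegative
  combination of s.o.s-convex polynomials that vanishes to first order, hence a sum of squares.\<close>


section \<open>Polynomial algebra\<close>

text \<open>An integral of squares is a limit of sums of squares, so using one directly would call
  for closedness of the cone of sums of squares. Both integrals are instead reduced to finite
  algebra. In the Taylor remainder the integrand is the square of a polynomial in t whose
  coefficients are polynomials in x; the integral is a positive semidefinite form in these
  coefficients, and completing squares gives an explicit sum. In the Lagrangian the measure is
  matched only through one vector, the gradient at the minimizer, so a barycentre argument in R^m
  suffices. The atomic Lagrangian may differ from the original one elsewhere; its nonnegativity is a
  consequence of s.o.s-convexity and stationarity, not a premise.

  The alternative in (A2) is a matter of signs. Where f is nonnegative, convexity of -g points in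
  the right direction; where f is negative, g itself must also be convex, and being affine makes
  Jensen's inequality for g an equality.\<close>

lemma lookup_scaleR [simp]:
  "Poly_Mapping.lookup (c *\<^sub>R h) k = c *\<^sub>R Poly_Mapping.lookup (h :: 'k \<Rightarrow>\<^sub>0 real) k"
proof -
  have "finite {i. c *\<^sub>R Poly_Mapping.lookup h i \<noteq> 0}"
    by (rule finite_subset[OF _ finite_lookup[of h]]) auto
  then show ?thesis
    by (simp add: scaleR_poly_mapping_def)
qed

lemma single_eq_scaleR_monomial: "Poly_Mapping.single \<alpha> c = c *\<^sub>R monomial \<alpha>"
  by (rule poly_mapping_eqI) (simp add: monomial_def lookup_single when_def)

lemma scaleR_single: "c *\<^sub>R Poly_Mapping.single k d = Poly_Mapping.single k (c * d :: real)"
  by (rule poly_mapping_eqI) (simp add: lookup_single when_def)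

lemma mpoly_induct [case_names zero single add]:
  fixes h :: "'k \<Rightarrow>\<^sub>0 real"
  assumes "P 0" and "\<And>k c. P (Poly_Mapping.single k c)" and "\<And>a b. P a \<Longrightarrow> P b \<Longrightarrow> P (a + b)"
  shows "P h"
proof (induction h rule: update_induct)
  case (update f k c)
  have "Poly_Mapping.update k c f = Poly_Mapping.single k c + f"
    using update(1)
    by (intro poly_mapping_eqI) (auto simp: lookup_update lookup_add lookup_single when_def in_keys_iff)
  with assms update show ?case by simp
qed (use assms in auto)

text \<open>Evaluation, partial differentiation and partial application of a functional are all sums
  over \<open>keys\<close> of coefficients times fixed vectors. Although the support varies, missing
  keys contribute zero, so one argument gives linearity for all of them.\<close>

lemma linear_keys_sum:
  fixes v :: "'k \<Rightarrow> 'b::real_vector"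
  shows "linear (\<lambda>h :: 'k \<Rightarrow>\<^sub>0 real. \<Sum>k\<in>Poly_Mapping.keys h. Poly_Mapping.lookup h k *\<^sub>R v k)"
proof (rule linearI)
  fix a b :: "'k \<Rightarrow>\<^sub>0 real" and c :: real
  show "(\<Sum>k\<in>Poly_Mapping.keys (a + b). Poly_Mapping.lookup (a + b) k *\<^sub>R v k) =
      (\<Sum>k\<in>Poly_Mapping.keys a. Poly_Mapping.lookup a k *\<^sub>R v k) +
      (\<Sum>k\<in>Poly_Mapping.keys b. Poly_Mapping.lookup b k *\<^sub>R v k)"
    by (rule setsum_keys_plus_distrib) (auto simp: scaleR_add_left)
  have "Poly_Mapping.keys (c *\<^sub>R a) = (if c = 0 then {} else Poly_Mapping.keys a)"
    by (auto simp: in_keys_iff)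
  then show "(\<Sum>k\<in>Poly_Mapping.keys (c *\<^sub>R a). Poly_Mapping.lookup (c *\<^sub>R a) k *\<^sub>R v k) =
      c *\<^sub>R (\<Sum>k\<in>Poly_Mapping.keys a. Poly_Mapping.lookup a k *\<^sub>R v k)"
    by (simp add: scaleR_sum_right)
qed

lemma linear_eval: "linear (\<lambda>h. eval h x)"
  using linear_keys_sum[of "\<lambda>\<alpha>. \<Prod>i\<in>UNIV. (x $ i) ^ Poly_Mapping.lookup \<alpha> i"]
  by (simp add: eval_def)

lemma linear_partial_deriv: "linear (partial_deriv i)"
  using linear_keys_sum[of "\<lambda>\<alpha>. Poly_Mapping.single (\<alpha> - Poly_Mapping.single i 1)
       (real (Poly_Mapping.lookup \<alpha> i))"]
  by (simp add: partial_deriv_def[abs_def] scaleR_single mult.commute)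

lemma linear_apply_x: "linear (apply_x L)"
  using linear_keys_sum[of "\<lambda>(\<alpha>, \<beta>). Poly_Mapping.single \<beta> (L (monomial \<alpha>))"]
  by (simp add: apply_x_def[abs_def] case_prod_unfold scaleR_single)

lemma linear_apply_y: "linear (apply_y H)"
  using linear_keys_sum[of "\<lambda>(\<alpha>, \<beta>). Poly_Mapping.single \<alpha> (H (monomial \<beta>))"]
  by (simp add: apply_y_def[abs_def] case_prod_unfold scaleR_single)

lemmas eval_add = linear_add[OF linear_eval]
  and eval_diff = linear_diff[OF linear_eval]
  and eval_minus = linear_neg[OF linear_eval]
  and eval_scaleR = linear_cmul[OF linear_eval]
  and eval_0 = linear_0[OF linear_eval]
  and eval_sum = linear_sum[OF linear_eval]

lemma eval_single:
  "eval (Poly_Mapping.single \<alpha> c) x = c * (\<Prod>i\<in>UNIV. (x $ i) ^ Poly_Mapping.lookup \<alpha> i)"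
  by (simp add: eval_def)

lemma eval_monomial: "eval (monomial \<alpha>) x = (\<Prod>i\<in>UNIV. (x $ i) ^ Poly_Mapping.lookup \<alpha> i)"
  by (simp add: monomial_def eval_single)

lemma eval_mult: "eval (a * b) x = eval a x * eval b x"
proof (induction a rule: mpoly_induct)
  case (single \<alpha> c)
  show ?case
  proof (induction b rule: mpoly_induct)
    case (single \<beta> d)
    show ?case
      by (simp add: mult_single eval_single lookup_add power_add prod.distrib)
  qed (simp_all add: eval_0 eval_add algebra_simps)
qed (simp_all add: eval_0 eval_add algebra_simps)

abbreviation const :: "real \<Rightarrow> 'v mpoly" where
  "const \<equiv> Poly_Mapping.single 0"

lemma eval_const: "eval (const c) x = c"
  by (simp add: eval_single)

lemma eval_1: "eval 1 x = 1"
  using eval_const[of 1] by simp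

lemma eval_numeral: "eval (numeral k) x = numeral k"
  using eval_const[of "numeral k"] by simp

lemma eval_power: "eval (a ^ n) x = eval a x ^ n"
  by (induction n) (simp_all add: eval_1 eval_mult)

lemma eval_variable: "eval (variable i) x = x $ i"
proof -
  have "(\<Prod>j\<in>UNIV. (x $ j) ^ Poly_Mapping.lookup (Poly_Mapping.single i (1::nat)) j) =
      (\<Prod>j\<in>UNIV. if j = i then x $ i else 1)"
    by (rule prod.cong) (auto simp: lookup_single when_def)
  then show ?thesis by (simp add: variable_def eval_monomial)
qed

lemmas eval_simps = eval_add eval_diff eval_minus eval_scaleR eval_0 eval_sum eval_mult
  eval_const eval_1 eval_numeral eval_power eval_variable

lemma scaleR_eq_const_mult: "c *\<^sub>R h = const c * (h :: 'v mpoly)"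
proof (induction h rule: mpoly_induct)
  case (single \<alpha> d)
  then show ?case by (simp add: scaleR_single mult_single)
qed (simp_all add: scaleR_add_right algebra_simps)

lemma monomial_mult_variable: "monomial \<alpha> * variable i = monomial (\<alpha> + Poly_Mapping.single i 1)"
  by (simp add: monomial_def variable_def mult_single)

lemma monomial_0: "monomial 0 = 1"
  by (simp add: monomial_def)

lemma poly_mapping_nat_induct [case_names zero Suc]:
  fixes \<alpha> :: "'v \<Rightarrow>\<^sub>0 nat"
  assumes "P 0" and "\<And>\<alpha> i. P \<alpha> \<Longrightarrow> P (\<alpha> + Poly_Mapping.single i 1)"
  shows "P \<alpha>"
proof (induction \<alpha> rule: update_induct)
  case (update f k c)
  have "P (f + Poly_Mapping.single k n)" for n
  proof (induction n)
    case (Suc n)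
    have "f + Poly_Mapping.single k (Suc n) =
        (f + Poly_Mapping.single k n) + Poly_Mapping.single k 1"
      by (simp add: add.assoc flip: single_add)
    with Suc assms(2) show ?case by presburger
  qed (simp add: update)
  moreover have "Poly_Mapping.update k c f = f + Poly_Mapping.single k c"
    using update(1)
    by (intro poly_mapping_eqI) (auto simp: lookup_update lookup_add lookup_single when_def in_keys_iff)
  ultimately show ?case by simp
qed (rule assms)

lemma mpoly_ring_induct [case_names const variable add mult]:
  fixes h :: "'v mpoly"
  assumes "\<And>c. P (const c)" and "\<And>i. P (variable i)"
    and add: "\<And>a b. P a \<Longrightarrow> P b \<Longrightarrow> P (a + b)" and mult: "\<And>a b. P a \<Longrightarrow> P b \<Longrightarrow> P (a * b)"
  shows "P h"
proof (induction h rule: mpoly_induct)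
  case zero
  show ?case using assms(1)[of 0] by simp
next
  case (single \<alpha> c)
  have "P (monomial \<alpha>)"
  proof (induction \<alpha> rule: poly_mapping_nat_induct)
    case zero
    show ?case using assms(1)[of 1] by (simp add: monomial_0)
  next
    case (Suc \<alpha> i)
    then show ?case by (metis monomial_mult_variable assms(2) mult)
  qed
  then show ?case
    by (metis single_eq_scaleR_monomial scaleR_eq_const_mult assms(1) mult)
qed (rule add)

lemma continuous_on_eval: "continuous_on A (eval h)"
  by (auto simp: eval_def[abs_def] intro!: continuous_intros)


text \<open>A polynomial function determines its coefficients: induction on the number of variables,
  splitting off the powers of one of them.\<close>

lemma monomial_functions_independent:
  fixes A :: "('v::finite \<Rightarrow>\<^sub>0 nat) set"
  assumes "finite S" "finite A"
    and "\<And>\<alpha> \<beta>. \<alpha> \<in> A \<Longrightarrow> \<beta> \<in> A \<Longrightarrow> (\<forall>i\<in>S. Poly_Mapping.lookup \<alpha> i = Poly_Mapping.lookup \<beta> i) \<Longrightarrow> \<alpha> = \<beta>"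
    and "\<And>x :: 'v \<Rightarrow> real. (\<Sum>\<alpha>\<in>A. c \<alpha> * (\<Prod>i\<in>S. x i ^ Poly_Mapping.lookup \<alpha> i)) = 0"
    and "\<alpha> \<in> A"
  shows "c \<alpha> = 0"
  using assms
proof (induction S arbitrary: A \<alpha> rule: finite_induct)
  case empty
  then have "A = {\<alpha>}" by auto
  with empty(3) show ?case by simp
next
  case (insert i S)
  define k where "k = Poly_Mapping.lookup \<alpha> i"
  define B where "B j = {\<alpha>\<in>A. Poly_Mapping.lookup \<alpha> i = j}" for j
  have 1: "(\<Sum>\<alpha>\<in>B k. c \<alpha> * (\<Prod>i\<in>S. x i ^ Poly_Mapping.lookup \<alpha> i)) = 0" for x
  proof -
    define F where "F j = (\<Sum>\<alpha>\<in>B j. c \<alpha> * (\<Prod>i\<in>S. x i ^ Poly_Mapping.lookup \<alpha> i))" for j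
    obtain N where N: "\<And>\<alpha>. \<alpha> \<in> A \<Longrightarrow> Poly_Mapping.lookup \<alpha> i \<le> N"
    proof
      show "Poly_Mapping.lookup \<alpha> i \<le> Max ((\<lambda>\<alpha>. Poly_Mapping.lookup \<alpha> i) ` A)" if "\<alpha> \<in> A" for \<alpha>
        using that insert.prems(1) by simp
    qed
    have "(\<Sum>j\<le>N. F j * t ^ j) = 0" for t
    proof -
      have "(\<Sum>\<alpha>\<in>A. c \<alpha> * (\<Prod>l\<in>insert i S. (x(i := t)) l ^ Poly_Mapping.lookup \<alpha> l)) =
        (\<Sum>\<alpha>\<in>A. c \<alpha> * (\<Prod>l\<in>S. x l ^ Poly_Mapping.lookup \<alpha> l) * t ^ Poly_Mapping.lookup \<alpha> i)"
      proof (rule sum.cong)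
        fix \<alpha>
        have "(\<Prod>l\<in>S. (x(i := t)) l ^ Poly_Mapping.lookup \<alpha> l) = (\<Prod>l\<in>S. x l ^ Poly_Mapping.lookup \<alpha> l)"
          using insert.hyps by (intro prod.cong) auto
        then show "c \<alpha> * (\<Prod>l\<in>insert i S. (x(i := t)) l ^ Poly_Mapping.lookup \<alpha> l) =
          c \<alpha> * (\<Prod>l\<in>S. x l ^ Poly_Mapping.lookup \<alpha> l) * t ^ Poly_Mapping.lookup \<alpha> i"
          using insert.hyps by simp
      qed simp
      also have "\<dots> = (\<Sum>j\<le>N. \<Sum>\<alpha>\<in>B j. c \<alpha> * (\<Prod>l\<in>S. x l ^ Poly_Mapping.lookup \<alpha> l) * t ^ Poly_Mapping.lookup \<alpha> i)"
        unfolding B_def by (rule sum.group[symmetric]) (use insert.prems(1) N in auto)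
      also have "\<dots> = (\<Sum>j\<le>N. F j * t ^ j)"
        by (rule sum.cong) (auto simp: F_def B_def sum_distrib_right)
      finally show ?thesis using insert.prems(3) by simp
    qed
    then have "F k = 0"
      using polyfun_eq_0[of F N] N[OF insert.prems(4)] by (simp add: k_def)
    then show ?thesis by (simp add: F_def)
  qed
  have "\<alpha> \<in> B k" using insert.prems by (simp add: B_def k_def)
  moreover have "finite (B k)" using insert.prems by (simp add: B_def)
  moreover have "\<beta> = \<gamma>" if "\<beta> \<in> B k" "\<gamma> \<in> B k"
    "\<forall>i\<in>S. Poly_Mapping.lookup \<beta> i = Poly_Mapping.lookup \<gamma> i" for \<beta> \<gamma>
    using that insert.prems(2)[of \<beta> \<gamma>] by (simp add: B_def)
  ultimately show ?case using insert.IH[of "B k"] 1 by blast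
qed

lemma eval_eq_0_imp:
  fixes h :: "'v::finite mpoly"
  assumes "\<And>x. eval h x = 0"
  shows "h = 0"
proof (rule poly_mapping_eqI, simp, rule ccontr)
  fix \<alpha> assume *: "Poly_Mapping.lookup h \<alpha> \<noteq> 0"
  have "Poly_Mapping.lookup h \<alpha> = 0"
  proof (rule monomial_functions_independent[of UNIV "Poly_Mapping.keys h"])
    show "(\<Sum>\<alpha>\<in>Poly_Mapping.keys h. Poly_Mapping.lookup h \<alpha> *
        (\<Prod>i\<in>UNIV. x i ^ Poly_Mapping.lookup \<alpha> i)) = 0" for x
      using assms[of "\<chi> i. x i"] by (simp add: eval_def)
  qed (use * in \<open>auto simp: in_keys_iff intro: poly_mapping_eqI\<close>)
  with * show False by simp
qed

text \<open>Reduces identities in the polynomial ring to identities of real functions, where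
  calculus and field arithmetic apply.\<close>

lemma eval_inject: "(\<And>x. eval a x = eval b x) \<Longrightarrow> a = b"
  using eval_eq_0_imp[of "a - b"] by (simp add: eval_diff)


subsection \<open>Degrees\<close>

lemma deg_le_iff: "deg h \<le> n \<longleftrightarrow> (\<forall>\<alpha>\<in>Poly_Mapping.keys h. monomial_degree \<alpha> \<le> n)"
  by (auto simp: deg_def)

lemma deg_add_le: "deg a \<le> n \<Longrightarrow> deg b \<le> n \<Longrightarrow> deg (a + b) \<le> n"
  using keys_add[of a b] by (auto simp: deg_le_iff)

lemma deg_scaleR_le: "deg a \<le> n \<Longrightarrow> deg (c *\<^sub>R a) \<le> n"
  by (auto simp: deg_le_iff in_keys_iff)

lemma deg_minus [simp]: "deg (- a) = deg a"
  by (simp add: deg_def)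

lemma deg_diff_le: "deg a \<le> n \<Longrightarrow> deg b \<le> n \<Longrightarrow> deg (a - b) \<le> n"
  using deg_add_le[of a n "- b"] by simp

lemma deg_0 [simp]: "deg 0 = 0"
  by (simp add: deg_def)

lemma deg_sum_le: "(\<And>i. i \<in> I \<Longrightarrow> deg (a i) \<le> n) \<Longrightarrow> deg (sum a I) \<le> n"
  by (induction I rule: infinite_finite_induct) (auto intro: deg_add_le)

lemma monomial_degree_add: "monomial_degree (\<alpha> + \<beta>) = monomial_degree \<alpha> + monomial_degree \<beta>"
  by (simp add: monomial_degree_def lookup_add sum.distrib)

lemma monomial_degree_0 [simp]: "monomial_degree 0 = 0"
  by (simp add: monomial_degree_def)

lemma monomial_degree_single [simp]: "monomial_degree (Poly_Mapping.single i k) = k"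
  by (simp add: monomial_degree_def lookup_single when_def)

lemma deg_mult_le: "deg a \<le> m \<Longrightarrow> deg b \<le> n \<Longrightarrow> deg (a * b) \<le> m + n"
  using keys_mult[of a b] by (fastforce simp: deg_le_iff monomial_degree_add intro: add_mono)

lemma deg_single_le: "monomial_degree \<alpha> \<le> n \<Longrightarrow> deg (Poly_Mapping.single \<alpha> c) \<le> n"
  by (simp add: deg_le_iff)

lemma deg_variable_le: "deg (variable i) \<le> 1"
  by (simp add: variable_def monomial_def deg_single_le)

lemma deg_power_le: "deg a \<le> m \<Longrightarrow> deg (a ^ n) \<le> n * m"
proof (induction n)
  case 0
  have "deg (const 1) \<le> 0" by (rule deg_single_le) simp
  then show ?case by simp
next
  case (Suc n)
  then show ?case using deg_mult_le[of a m "a ^ n" "n * m"] by simp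
qed

lemma deg_keys_induct [consumes 1, case_names zero monomial add]:
  assumes "deg h \<le> n" and "P 0"
    and "\<And>\<alpha> c. monomial_degree \<alpha> \<le> n \<Longrightarrow> P (Poly_Mapping.single \<alpha> c)"
    and "\<And>a b. P a \<Longrightarrow> P b \<Longrightarrow> P (a + b)"
  shows "P h"
proof -
  have "h = (\<Sum>\<alpha>\<in>Poly_Mapping.keys h. Poly_Mapping.single \<alpha> (Poly_Mapping.lookup h \<alpha>))"
    by (rule poly_mapping_eqI)
      (auto simp: lookup_sum lookup_single when_def in_keys_iff sum.delta)
  moreover have "P (\<Sum>\<alpha>\<in>A. Poly_Mapping.single \<alpha> (Poly_Mapping.lookup h \<alpha>))"
    if "finite A" "A \<subseteq> Poly_Mapping.keys h" for A
    using that by (induction A rule: finite_induct) (use assms in \<open>auto simp: deg_le_iff\<close>)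
  ultimately show ?thesis by (metis finite_keys order_refl)
qed


section \<open>Sums of squares\<close>

lemma sosI: "h = (\<Sum>k<r::nat. q k ^ 2) \<Longrightarrow> h \<in> sos"
  by (auto simp: sos_def)

lemma sos_0: "0 \<in> sos"
  by (rule sosI[of _ _ 0]) simp

lemma sos_add_square:
  assumes "h \<in> sos" shows "h + q ^ 2 \<in> sos"
proof -
  obtain r :: nat and p where h: "h = (\<Sum>k<r. p k ^ 2)" using assms by (auto simp: sos_def)
  have "h + q ^ 2 = (\<Sum>k<Suc r. (if k < r then p k else q) ^ 2)"
    by (simp add: h)
  then show ?thesis by (rule sosI)
qed

lemma sos_add:
  assumes "a \<in> sos" "b \<in> sos" shows "a + b \<in> sos"
proof -
  obtain r :: nat and q where b: "b = (\<Sum>k<r. q k ^ 2)" using assms by (auto simp: sos_def)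
  have "a + (\<Sum>k<r. q k ^ 2) \<in> sos"
    by (induction r) (auto simp: assms(1) add.assoc[symmetric] intro: sos_add_square)
  with b show ?thesis by simp
qed

lemma sos_square: "q ^ 2 \<in> sos"
  using sos_add_square[OF sos_0, of q] by simp

lemma sos_sum: "(\<And>i. i \<in> I \<Longrightarrow> a i \<in> sos) \<Longrightarrow> sum a I \<in> sos"
  by (induction I rule: infinite_finite_induct) (auto intro: sos_0 sos_add)

lemma sos_mult_square:
  assumes "h \<in> sos" shows "q ^ 2 * h \<in> sos"
proof -
  obtain r :: nat and p where h: "h = (\<Sum>k<r. p k ^ 2)" using assms by (auto simp: sos_def)
  have "q ^ 2 * h = (\<Sum>k<r. (q * p k) ^ 2)"
    by (simp add: h sum_distrib_left power_mult_distrib)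
  then show ?thesis by (rule sosI)
qed

lemma sos_scaleR:
  assumes "h \<in> sos" "0 \<le> c" shows "c *\<^sub>R h \<in> sos"
proof -
  have "const c = const (sqrt c) ^ 2"
    using assms(2) by (simp add: power2_eq_square mult_single)
  then show ?thesis using sos_mult_square[OF assms(1)] by (metis scaleR_eq_const_mult)
qed

lemma sos_const: "0 \<le> c \<Longrightarrow> const c \<in> sos"
  using sos_scaleR[OF sos_square[of 1]] by (simp add: scaleR_eq_const_mult)

lemma sos_eval_nonneg: "h \<in> sos \<Longrightarrow> 0 \<le> eval h x"
  by (auto simp: sos_def eval_simps intro!: sum_nonneg)

section \<open>Positive semidefinite quadratic forms as sums of squares\<close>

lemma sum_sum_insert:
  fixes F :: "'i \<Rightarrow> 'i \<Rightarrow> 'a::comm_ring_1"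
  assumes "finite S" "i \<notin> S" "\<And>j. j \<in> S \<Longrightarrow> F j i = F i j"
  shows "(\<Sum>j\<in>insert i S. \<Sum>k\<in>insert i S. F j k) =
    F i i + 2 * (\<Sum>j\<in>S. F i j) + (\<Sum>j\<in>S. \<Sum>k\<in>S. F j k)"
  using assms by (simp add: sum.distrib algebra_simps)

text \<open>Completing squares, one variable at a time.\<close>

lemma psd_form_sos:
  fixes B :: "'i \<Rightarrow> 'i \<Rightarrow> real" and u :: "'i \<Rightarrow> 'v mpoly"
  assumes "finite S"
    and "\<And>i j. i \<in> S \<Longrightarrow> j \<in> S \<Longrightarrow> B i j = B j i"
    and "\<And>c. 0 \<le> (\<Sum>i\<in>S. \<Sum>j\<in>S. B i j * (c i * c j))"
  shows "(\<Sum>i\<in>S. \<Sum>j\<in>S. const (B i j) * (u i * u j)) \<in> sos"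
  using assms
proof (induction S arbitrary: B rule: finite_induct)
  case empty
  then show ?case by (simp add: sos_0)
next
  case (insert i S)
  define b where "b = B i i"
  have expand: "(\<Sum>j\<in>insert i S. \<Sum>k\<in>insert i S. B j k * (c j * c k)) =
      b * (c i)\<^sup>2 + 2 * c i * (\<Sum>j\<in>S. B i j * c j) + (\<Sum>j\<in>S. \<Sum>k\<in>S. B j k * (c j * c k))" for c
    using insert.hyps insert.prems(1)
    by (subst sum_sum_insert) (auto simp: b_def power2_eq_square sum_distrib_left algebra_simps)
  have expand_u: "(\<Sum>j\<in>insert i S. \<Sum>k\<in>insert i S. const (B j k) * (u j * u k)) =
      const b * (u i)\<^sup>2 + 2 * u i * (\<Sum>j\<in>S. const (B i j) * u j) +
      (\<Sum>j\<in>S. \<Sum>k\<in>S. const (B j k) * (u j * u k))"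
    using insert.hyps insert.prems(1)
    by (subst sum_sum_insert) (auto simp: b_def power2_eq_square sum_distrib_left algebra_simps)
  have b0: "0 \<le> b"
  proof -
    have "0 \<le> b * 1\<^sup>2"
      using insert.prems(2)[of "\<lambda>j. if j = i then 1 else 0"] insert.hyps
      unfolding expand by (simp add: sum.neutral if_distrib cong: if_cong)
    then show ?thesis by simp
  qed
  show ?case
  proof (cases "b = 0")
    case True
    have B0: "B i j = 0" if j: "j \<in> S" for j
    proof (rule ccontr)
      assume nz: "B i j \<noteq> 0"
      \<comment> \<open>With a zero diagonal entry the form is affine in \<open>c i\<close>. This t
        makes its value -1.\<close>
      define t where "t = - (B j j + 1) / (2 * B i j)"
      have ij: "i \<noteq> j" using insert.hyps j by blast
      define c where "c = (\<lambda>k. if k = i then t else if k = j then 1 else 0)"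
      have c: "c k = (if k = j then 1 else 0)" if "k \<in> S" for k
        using that insert.hyps by (auto simp: c_def)
      have "(\<Sum>k\<in>S. B i k * c k) = B i j"
        using insert.hyps j by (simp add: c if_distrib[of "(*) _"] cong: if_cong)
      moreover have "(\<Sum>k\<in>S. \<Sum>l\<in>S. B k l * (c k * c l)) = B j j"
      proof -
        have "(\<Sum>k\<in>S. \<Sum>l\<in>S. B k l * (c k * c l)) =
            (\<Sum>k\<in>S. if k = j then \<Sum>l\<in>S. if l = j then B j j else 0 else 0)"
          by (auto intro!: sum.cong simp: c)
        also have "\<dots> = B j j"
          using insert.hyps j by simp
        finally show ?thesis .
      qed
      moreover have "c i = t" by (simp add: c_def)
      ultimately have "0 \<le> 2 * t * B i j + B j j"
        using insert.prems(2)[of c] unfolding expand by (simp add: True)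
      moreover have "2 * t * B i j = - (B j j + 1)" using nz by (simp add: t_def)
      ultimately show False by simp
    qed
    have "(\<Sum>j\<in>S. \<Sum>k\<in>S. const (B j k) * (u j * u k)) \<in> sos"
    proof (rule insert.IH)
      show "0 \<le> (\<Sum>j\<in>S. \<Sum>k\<in>S. B j k * (c j * c k))" for c
        using insert.prems(2)[of c] B0 unfolding expand by (simp add: True)
    qed (use insert.prems in auto)
    then show ?thesis unfolding expand_u using B0 by (simp add: True)
  next
    case False
    then have b: "0 < b" using b0 by simp
    \<comment> \<open>The Schur complement of the pivot b.\<close>
    define B' where "B' j k = B j k - B i j * B i k / b" for j k
    define V where "V = (\<Sum>j\<in>S. const (B i j) * u j)"
    have "(\<Sum>j\<in>S. \<Sum>k\<in>S. const (B' j k) * (u j * u k)) \<in> sos"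
    proof (rule insert.IH)
      show "B' j k = B' k j" if "j \<in> S" "k \<in> S" for j k
        using that insert.prems(1) by (simp add: B'_def)
      show "0 \<le> (\<Sum>j\<in>S. \<Sum>k\<in>S. B' j k * (c j * c k))" for c
      proof -
        define w where "w = (\<Sum>j\<in>S. B i j * c j)"
        \<comment> \<open>The value of \<open>c i\<close> that makes the completed square vanish, so
          that only the Schur complement remains.\<close>
        define c' where "c' = c(i := - w / b)"
        have c': "c' j = c j" if "j \<in> S" for j using that insert.hyps by (auto simp: c'_def)
        have "0 \<le> b * (w / b)\<^sup>2 - 2 * (w / b) * w + (\<Sum>j\<in>S. \<Sum>k\<in>S. B j k * (c j * c k))"
        proof -
          have "(\<Sum>j\<in>S. B i j * c' j) = w"
            "(\<Sum>j\<in>S. \<Sum>k\<in>S. B j k * (c' j * c' k)) = (\<Sum>j\<in>S. \<Sum>k\<in>S. B j k * (c j * c k))"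
            by (simp_all add: c' w_def)
          then show ?thesis
            using insert.prems(2)[of c'] unfolding expand by (simp add: c'_def)
        qed
        also have "\<dots> = (\<Sum>j\<in>S. \<Sum>k\<in>S. B j k * (c j * c k)) - w * w / b"
          using b by (simp add: field_simps power2_eq_square)
        also have "w * w / b = (\<Sum>j\<in>S. \<Sum>k\<in>S. B i j * B i k / b * (c j * c k))"
          by (simp add: w_def sum_product sum_divide_distrib algebra_simps)
        finally show ?thesis by (simp add: B'_def left_diff_distrib sum_subtractf)
      qed
    qed
    moreover have "b *\<^sub>R (u i + const (1 / b) * V)\<^sup>2 \<in> sos"
      using b by (intro sos_scaleR sos_square) simp
    moreover have "(\<Sum>j\<in>insert i S. \<Sum>k\<in>insert i S. const (B j k) * (u j * u k)) =
        b *\<^sub>R (u i + const (1 / b) * V)\<^sup>2 + (\<Sum>j\<in>S. \<Sum>k\<in>S. const (B' j k) * (u j * u k))"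
    proof -
      have [simp]: "const b * (const (1 / b) * X) = X" for X
        using b by (simp add: mult.assoc[symmetric] mult_single)
      have "b *\<^sub>R (u i + const (1 / b) * V)\<^sup>2 = const b * (u i)\<^sup>2 + 2 * u i * V + const (1 / b) * (V * V)"
      proof -
        have "const b * (u i + const (1 / b) * V)\<^sup>2 = const b * (u i)\<^sup>2 +
            2 * u i * (const b * (const (1 / b) * V)) + const b * (const (1 / b) * (const (1 / b) * (V * V)))"
          by (simp add: power2_eq_square algebra_simps del: \<open>\<And>X. const b * (const (1 / b) * X) = X\<close>)
        then show ?thesis by (simp add: scaleR_eq_const_mult)
      qed
      moreover have "const (1 / b) * (V * V) = (\<Sum>j\<in>S. \<Sum>k\<in>S. const (B i j * B i k / b) * (u j * u k))"
        unfolding V_def sum_product unfolding sum_distrib_left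
      proof (intro sum.cong refl)
        fix j k :: 'i
        have 1: "const (B i j * B i k / b) = const (1 / b) * const (B i j) * const (B i k)"
          by (simp add: mult_single)
        show "const (1 / b) * (const (B i j) * u j * (const (B i k) * u k)) =
            const (B i j * B i k / b) * (u j * u k)"
          unfolding 1 by (simp only: mult_ac)
      qed
      ultimately show ?thesis
        unfolding expand_u B'_def V_def[symmetric]
        by (simp add: single_diff left_diff_distrib sum_subtractf)
    qed
    ultimately show ?thesis by (simp add: sos_add)
  qed
qed


section \<open>Derivatives and the Taylor remainder\<close>

lemmas partial_deriv_add = linear_add[OF linear_partial_deriv]
  and partial_deriv_scaleR = linear_cmul[OF linear_partial_deriv]
  and partial_deriv_0 = linear_0[OF linear_partial_deriv]

lemma partial_deriv_single:
  "partial_deriv i (Poly_Mapping.single \<alpha> c) =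
    Poly_Mapping.single (\<alpha> - Poly_Mapping.single i 1) (real (Poly_Mapping.lookup \<alpha> i) * c)"
  by (simp add: partial_deriv_def)

lemma deg_partial_deriv_le: "deg h \<le> n \<Longrightarrow> deg (partial_deriv i h) \<le> n - 1"
proof (induction rule: deg_keys_induct)
  case (monomial \<alpha> c)
  show ?case
  proof (cases "Poly_Mapping.lookup \<alpha> i = 0")
    case False
    have "\<alpha> = (\<alpha> - Poly_Mapping.single i 1) + Poly_Mapping.single i 1"
      using False by (intro poly_mapping_eqI) (auto simp: lookup_add lookup_minus lookup_single when_def)
    then have "monomial_degree \<alpha> = monomial_degree (\<alpha> - Poly_Mapping.single i 1) + 1"
      by (metis monomial_degree_add monomial_degree_single)
    then show ?thesis using monomial by (simp add: partial_deriv_single deg_single_le)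
  qed (simp add: partial_deriv_single)
qed (auto simp: partial_deriv_0 partial_deriv_add intro: deg_add_le)

lemma partial_deriv_deg_0: "deg h \<le> 0 \<Longrightarrow> partial_deriv i h = 0"
proof (induction rule: deg_keys_induct)
  case (monomial \<alpha> c)
  then have "Poly_Mapping.lookup \<alpha> i = 0" by (simp add: monomial_degree_def)
  then show ?case by (simp add: partial_deriv_single)
qed (auto simp: partial_deriv_0 partial_deriv_add)

text \<open>The bridge from formal partial derivatives to calculus: the later differentiations all
  take place on lines, in one real variable t.\<close>

lemma DERIV_eval_line:
  "((\<lambda>t. eval h (a + t *\<^sub>R v)) has_real_derivative
    (\<Sum>i\<in>UNIV. eval (partial_deriv i h) (a + t *\<^sub>R v) * v $ i)) (at t)"
proof (induction h rule: mpoly_induct)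
  case zero
  then show ?case by (simp add: eval_0 partial_deriv_0)
next
  case (add p q)
  from DERIV_add[OF add] show ?case
    by (simp add: eval_add partial_deriv_add distrib_right sum.distrib)
next
  case (single \<alpha> c)
  define e where "e = Poly_Mapping.lookup \<alpha>"
  define f where "f i t = (a $ i + t * v $ i) ^ e i" for i t
  define f' where "f' i = real (e i) * (a $ i + t * v $ i) ^ (e i - 1) * v $ i" for i
  have "((\<lambda>t. \<Prod>i\<in>UNIV. f i t) has_derivative (\<lambda>y. \<Sum>i\<in>UNIV. (f' i * y) * (\<Prod>j\<in>UNIV - {i}. f j t))) (at t)"
  proof (rule has_derivative_prod)
    show "(f i has_derivative (\<lambda>y. f' i * y)) (at t)" for i
    proof -
      have "(f i has_real_derivative f' i) (at t)"
        unfolding f_def[abs_def] f'_def by (auto intro!: derivative_eq_intros)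
      then show ?thesis by (simp add: has_field_derivative_def)
    qed
  qed
  moreover have "(\<lambda>y. \<Sum>i\<in>UNIV. (f' i * y) * (\<Prod>j\<in>UNIV - {i}. f j t)) =
      (*) (\<Sum>i\<in>UNIV. f' i * (\<Prod>j\<in>UNIV - {i}. f j t))"
    by (auto simp: fun_eq_iff sum_distrib_left sum_distrib_right algebra_simps)
  ultimately have "((\<lambda>t. \<Prod>i\<in>UNIV. f i t) has_real_derivative
      (\<Sum>i\<in>UNIV. f' i * (\<Prod>j\<in>UNIV - {i}. f j t))) (at t)"
    by (simp add: has_field_derivative_def)
  then have "((\<lambda>t. c * (\<Prod>i\<in>UNIV. f i t)) has_real_derivative
      c * (\<Sum>i\<in>UNIV. f' i * (\<Prod>j\<in>UNIV - {i}. f j t))) (at t)"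
    by (rule DERIV_cmult)
  moreover have "c * (\<Sum>i\<in>UNIV. f' i * (\<Prod>j\<in>UNIV - {i}. f j t)) =
      (\<Sum>i\<in>UNIV. eval (partial_deriv i (Poly_Mapping.single \<alpha> c)) (a + t *\<^sub>R v) * v $ i)"
    unfolding sum_distrib_left
  proof (rule sum.cong)
    fix i
    have "(\<Prod>j\<in>UNIV. ((a + t *\<^sub>R v) $ j) ^ Poly_Mapping.lookup (\<alpha> - Poly_Mapping.single i 1) j) =
        (a $ i + t * v $ i) ^ (e i - 1) * (\<Prod>j\<in>UNIV - {i}. f j t)"
      by (subst prod.remove[of UNIV i])
        (auto simp: e_def f_def lookup_minus lookup_single when_def intro!: prod.cong)
    then show "c * (f' i * (\<Prod>j\<in>UNIV - {i}. f j t)) =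
        eval (partial_deriv i (Poly_Mapping.single \<alpha> c)) (a + t *\<^sub>R v) * v $ i"
      unfolding partial_deriv_single eval_single by (simp add: f'_def e_def)
  qed simp
  ultimately show ?case by (simp add: eval_single f_def e_def)
qed

section \<open>Taylor remainders as sums of squares\<close>

definition taylor_remainder :: "real ^ 'v \<Rightarrow> 'v::finite mpoly \<Rightarrow> 'v mpoly" where
  "taylor_remainder a h = h - const (eval h a) -
    (\<Sum>i\<in>UNIV. const (eval (partial_deriv i h) a) * (variable i - const (a $ i)))"

lemma eval_taylor_remainder:
  "eval (taylor_remainder a h) x =
    eval h x - eval h a - (\<Sum>i\<in>UNIV. eval (partial_deriv i h) a * (x $ i - a $ i))"
  by (simp add: taylor_remainder_def eval_simps)

text \<open>Linearity allows the remainder of the Lagrangian to be split into the remainders of its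
  terms, each a sum of squares.\<close>

lemma linear_taylor_remainder: "linear (taylor_remainder a)"
  by (rule linearI; rule eval_inject)
    (simp_all add: eval_taylor_remainder eval_simps partial_deriv_add partial_deriv_scaleR
      sum.distrib sum_subtractf sum_distrib_left algebra_simps)

lemma deg_taylor_remainder_le:
  assumes "deg h \<le> n" shows "deg (taylor_remainder a h) \<le> n"
proof -
  have "deg (\<Sum>i\<in>UNIV. const (eval (partial_deriv i h) a) * (variable i - const (a $ i))) \<le> n"
  \<comment> \<open>The affine terms are only bounded by degree 1, which is too much for n = 0;
    there the gradient vanishes.\<close>
  proof (cases "n = 0")
    case True
    then show ?thesis using assms by (simp add: partial_deriv_deg_0 eval_0)
  next
    case False
    have "deg (const (eval (partial_deriv i h) a) * (variable i - const (a $ i))) \<le> 0 + 1" (is "deg (?l i) \<le> _") for i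
      by (intro deg_mult_le deg_diff_le deg_variable_le deg_single_le) auto
    then have "deg (?l i) \<le> n" for i
      using False le_trans[of "deg (?l i)" 1 n] by simp
    then show ?thesis by (rule deg_sum_le)
  qed
  then show ?thesis
    unfolding taylor_remainder_def using assms by (intro deg_diff_le deg_single_le) auto
qed

text \<open>Stands in for integration along a segment: an explicit function with the same second
  derivative is subtracted from a polynomial restricted to a line, and the difference is
  affine.\<close>

lemma eq_line_of_second_deriv_0:
  fixes G G' :: "real \<Rightarrow> real"
  assumes "\<And>t. (G has_real_derivative G' t) (at t)" and "\<And>t. (G' has_real_derivative 0) (at t)"
  shows "G 1 = G 0 + G' 0"
proof -
  have "G' t = G' 0" for t
    using DERIV_isconst_all[of G'] assms(2) by blast
  then have "((\<lambda>t. G t - t * G' 0) has_real_derivative 0) (at t)" for t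
    using assms(1)[of t] by (auto intro!: derivative_eq_intros)
  then have "G 1 - 1 * G' 0 = G 0 - 0 * G' 0"
    using DERIV_isconst_all[of "\<lambda>t. G t - t * G' 0"] by blast
  then show ?thesis by simp
qed

text \<open>The coefficients of \<open>\<integral>\<^sub>0\<^sup>1 (1 - t) (\<Sum>\<^sub>l A\<^sub>l t\<^sup>l)\<^sup>2 dt\<close> as a quadratic form in \<open>A\<close>. Its primitive below is the
  twofold antiderivative of the square, which vanishes to second order at 0.\<close>

definition remainder_weight :: "nat \<Rightarrow> nat \<Rightarrow> real" where
  "remainder_weight k l = 1 / (real (k + l + 1) * real (k + l + 2))"

definition square_primitive2 :: "nat \<Rightarrow> (nat \<Rightarrow> real) \<Rightarrow> real \<Rightarrow> real" where
  "square_primitive2 N A t =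
    (\<Sum>k\<le>N. \<Sum>l\<le>N. remainder_weight k l * (A k * A l) * t ^ (k + l + 2))"

definition square_primitive :: "nat \<Rightarrow> (nat \<Rightarrow> real) \<Rightarrow> real \<Rightarrow> real" where
  "square_primitive N A t = (\<Sum>k\<le>N. \<Sum>l\<le>N. (A k * A l) / real (k + l + 1) * t ^ (k + l + 1))"

lemma DERIV_square_primitive2:
  "(square_primitive2 N A has_real_derivative square_primitive N A t) (at t)"
proof -
  have "(square_primitive2 N A has_real_derivative
      (\<Sum>k\<le>N. \<Sum>l\<le>N. remainder_weight k l * (A k * A l) * (real (k + l + 2) * t ^ (k + l + 1)))) (at t)"
    unfolding square_primitive2_def[abs_def]
    by (intro DERIV_sum DERIV_cmult, rule derivative_eq_intros) (auto intro!: derivative_eq_intros)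
  moreover have "remainder_weight k l * (A k * A l) * (real (k + l + 2) * t ^ (k + l + 1)) =
      (A k * A l) / real (k + l + 1) * t ^ (k + l + 1)" for k l
  proof -
    have 1: "remainder_weight k l * real (k + l + 2) = 1 / real (k + l + 1)"
      unfolding remainder_weight_def by (simp add: field_simps del: of_nat_add of_nat_Suc)
    have "remainder_weight k l * (A k * A l) * (real (k + l + 2) * t ^ (k + l + 1)) =
        (remainder_weight k l * real (k + l + 2)) * (A k * A l) * t ^ (k + l + 1)"
      by (simp only: mult_ac)
    then show ?thesis unfolding 1 by simp
  qed
  ultimately show ?thesis by (simp only: square_primitive_def)
qed

lemma DERIV_square_primitive:
  "(square_primitive N A has_real_derivative (\<Sum>k\<le>N. A k * t ^ k)\<^sup>2) (at t)"
proof -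
  have "(square_primitive N A has_real_derivative
      (\<Sum>k\<le>N. \<Sum>l\<le>N. (A k * A l) / real (k + l + 1) * (real (k + l + 1) * t ^ (k + l)))) (at t)"
    unfolding square_primitive_def[abs_def]
    by (intro DERIV_sum DERIV_cmult, rule derivative_eq_intros) (auto intro!: derivative_eq_intros)
  moreover have "(\<Sum>k\<le>N. \<Sum>l\<le>N. (A k * A l) / real (k + l + 1) * (real (k + l + 1) * t ^ (k + l))) =
      (\<Sum>k\<le>N. A k * t ^ k)\<^sup>2"
    unfolding power2_eq_square sum_product
    by (intro sum.cong refl) (simp add: power_add del: of_nat_add of_nat_Suc)
  ultimately show ?thesis by (simp only:)
qed

text \<open>The form is the value at 1 of a function that vanishes with its first derivative at 0
  and whose second derivative is a square. Monotonicity is applied twice.\<close>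

lemma remainder_weight_psd:
  "0 \<le> (\<Sum>k\<le>N. \<Sum>l\<le>N. remainder_weight k l * (A k * A l))"
proof -
  have 0: "square_primitive N A 0 = 0" "square_primitive2 N A 0 = 0"
    by (simp_all add: square_primitive_def square_primitive2_def)
  have nonneg: "0 \<le> square_primitive N A t" if "0 \<le> t" for t
    using DERIV_nonneg_imp_nondecreasing[OF that, of "square_primitive N A"]
      DERIV_square_primitive[of N A] 0 by (metis zero_le_power2)
  have "square_primitive2 N A 0 \<le> square_primitive2 N A 1"
  proof (rule DERIV_nonneg_imp_nondecreasing[of 0 1 "square_primitive2 N A"])
    show "\<exists>y. (square_primitive2 N A has_real_derivative y) (at t) \<and> 0 \<le> y" if "0 \<le> t" for t
      using DERIV_square_primitive2[of N A t] nonneg[OF that] by blast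
  qed simp
  then show ?thesis using 0 by (simp add: square_primitive2_def)
qed

text \<open>\<open>W\<close> is a polynomial in t with coefficients in the polynomial ring in x. Its
  degree bounds the degree in t uniformly in x, and its coefficients are the polynomials that enter
  the quadratic form.\<close>

lemma eval_along_segment:
  fixes q :: "'v::finite mpoly"
  shows "\<exists>W :: 'v mpoly poly. \<forall>x t. eval (poly W (const t)) x = eval q (a + t *\<^sub>R (x - a))"
proof (induction q rule: mpoly_ring_induct)
  case (const c)
  show ?case by (rule exI[of _ "[:const c:]"]) (simp add: eval_simps)
next
  case (variable i)
  show ?case
    by (rule exI[of _ "[:const (a $ i), variable i - const (a $ i):]"]) (simp add: eval_simps)
next
  case (add p q)
  then obtain W W' where "\<forall>x t. eval (poly W (const t)) x = eval p (a + t *\<^sub>R (x - a))"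
    "\<forall>x t. eval (poly W' (const t)) x = eval q (a + t *\<^sub>R (x - a))" by blast
  then show ?case by (intro exI[of _ "W + W'"]) (simp add: eval_simps)
next
  case (mult p q)
  then obtain W W' where "\<forall>x t. eval (poly W (const t)) x = eval p (a + t *\<^sub>R (x - a))"
    "\<forall>x t. eval (poly W' (const t)) x = eval q (a + t *\<^sub>R (x - a))" by blast
  then show ?case by (intro exI[of _ "W * W'"]) (simp add: eval_simps)
qed

text \<open>\<open>h(x) - h(a) - \<nabla>h(a)(x - a) = \<integral>\<^sub>0\<^sup>1 (1 - t) \<parallel>H(a + t (x - a)) (x - a)\<parallel>\<^sup>2 dt\<close>, and integrating the square of
  a polynomial in \<open>t\<close> against a nonnegative weight gives a positive semidefinite form in its coefficients.\<close>

lemma taylor_remainder_sos: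
  assumes "sos_convex h" shows "taylor_remainder a h \<in> sos"
proof -
  obtain r :: nat and H where H: "\<And>i j. partial_deriv i (partial_deriv j h) = (\<Sum>k<r. H k i * H k j)"
    using assms by (auto simp: sos_convex_def)
  have "\<exists>W. \<forall>x t. eval (poly W (const t)) x =
      (\<Sum>i\<in>UNIV. eval (H k i) (a + t *\<^sub>R (x - a)) * (x $ i - a $ i))" for k
  proof -
    obtain V where V: "\<And>i x t. eval (poly (V i) (const t)) x = eval (H k i) (a + t *\<^sub>R (x - a))"
      using eval_along_segment[of "H k _" a] by metis
    show ?thesis
      by (rule exI[of _ "\<Sum>i\<in>UNIV. V i * [:variable i - const (a $ i):]"])
        (simp add: poly_sum V eval_simps mult.commute)
  qed
  then obtain W where W: "\<And>k x t. eval (poly (W k) (const t)) x =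
      (\<Sum>i\<in>UNIV. eval (H k i) (a + t *\<^sub>R (x - a)) * (x $ i - a $ i))"
    by metis
  \<comment> \<open>\<open>Suc r\<close> instead of r keeps the set nonempty when the Hessian factor
    has no rows.\<close>
  define N where "N = Max ((\<lambda>k. degree (W k)) ` {..<Suc r})"
  have N: "degree (W k) \<le> N" if "k < r" for k
    unfolding N_def using that by (intro Max_ge) auto
  have eval_W: "eval (poly (W k) (const t)) x = (\<Sum>l\<le>N. eval (coeff (W k) l) x * t ^ l)"
    if "k < r" for k x t
  proof -
    have "poly (W k) (const t) = (\<Sum>l\<le>N. coeff (W k) l * const t ^ l)"
      unfolding poly_altdef using N[OF that]
      by (intro sum.mono_neutral_left) (auto simp: coeff_eq_0)
    then show ?thesis by (simp add: eval_simps)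
  qed
  have "taylor_remainder a h =
      (\<Sum>k<r. \<Sum>i\<le>N. \<Sum>j\<le>N. const (remainder_weight i j) * (coeff (W k) i * coeff (W k) j))"
  proof (rule eval_inject)
    fix x
    define v where "v = x - a"
    define A where "A k l = eval (coeff (W k) l) x" for k l
    \<comment> \<open>By the factorization of the Hessian the subtracted sum has the second
      derivative of h along the segment, and it vanishes to first order at t = 0. Its value at t = 1
      is therefore the Taylor remainder.\<close>
    define G where "G t = eval h (a + t *\<^sub>R v) - (\<Sum>k<r. square_primitive2 N (A k) t)" for t
    define G' where "G' t = (\<Sum>i\<in>UNIV. eval (partial_deriv i h) (a + t *\<^sub>R v) * v $ i) -
        (\<Sum>k<r. square_primitive N (A k) t)" for t
    have "(G has_real_derivative G' t) (at t)" for t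
      unfolding G_def G'_def
      by (intro DERIV_diff DERIV_sum DERIV_eval_line DERIV_square_primitive2)
    moreover have "(G' has_real_derivative 0) (at t)" for t
    proof -
      have "(G' has_real_derivative
          (\<Sum>i\<in>UNIV. (\<Sum>j\<in>UNIV. eval (partial_deriv j (partial_deriv i h)) (a + t *\<^sub>R v) * v $ j) * v $ i) -
          (\<Sum>k<r. (\<Sum>l\<le>N. A k l * t ^ l)\<^sup>2)) (at t)"
        unfolding G'_def
        by (intro DERIV_diff DERIV_sum DERIV_cmult_right DERIV_eval_line DERIV_square_primitive)
      also have "(\<Sum>k<r. (\<Sum>l\<le>N. A k l * t ^ l)\<^sup>2) =
          (\<Sum>k<r. (\<Sum>i\<in>UNIV. eval (H k i) (a + t *\<^sub>R v) * v $ i)\<^sup>2)"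
        by (rule sum.cong) (simp_all add: A_def v_def W flip: eval_W)
      also have "\<dots> = (\<Sum>k<r. \<Sum>i\<in>UNIV. \<Sum>j\<in>UNIV. (eval (H k i) (a + t *\<^sub>R v) * v $ i) *
          (eval (H k j) (a + t *\<^sub>R v) * v $ j))"
        by (simp add: power2_eq_square sum_product)
      also have "\<dots> = (\<Sum>i\<in>UNIV. \<Sum>j\<in>UNIV. \<Sum>k<r. (eval (H k i) (a + t *\<^sub>R v) * v $ i) *
          (eval (H k j) (a + t *\<^sub>R v) * v $ j))"
        by (subst sum.swap, intro sum.cong refl, rule sum.swap)
      also have "\<dots> = (\<Sum>i\<in>UNIV. (\<Sum>j\<in>UNIV.
          eval (partial_deriv j (partial_deriv i h)) (a + t *\<^sub>R v) * v $ j) * v $ i)"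
        by (intro sum.cong refl) (simp add: H eval_simps sum_distrib_left sum_distrib_right algebra_simps)
      finally show ?thesis by simp
    qed
    ultimately have "G 1 = G 0 + G' 0" by (rule eq_line_of_second_deriv_0)
    then show "eval (taylor_remainder a h) x = eval (\<Sum>k<r. \<Sum>i\<le>N. \<Sum>j\<le>N.
        const (remainder_weight i j) * (coeff (W k) i * coeff (W k) j)) x"
      by (simp add: G_def G'_def v_def eval_taylor_remainder eval_simps square_primitive_def
          square_primitive2_def A_def)
  qed
  moreover have "(\<Sum>i\<le>N. \<Sum>j\<le>N. const (remainder_weight i j) * (coeff (W k) i * coeff (W k) j)) \<in> sos" for k
    by (rule psd_form_sos[OF _ _ remainder_weight_psd]) (simp_all add: remainder_weight_def add.commute)
  ultimately show ?thesis by (simp add: sos_sum)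
qed

text \<open>The Hessian is zero, the empty sum of squares. Hence Jensen's inequality for an affine g
  holds in both directions.\<close>

lemma affine_sos_convex:
  assumes "deg h \<le> 1" shows "sos_convex h"
proof -
  have "deg (partial_deriv j h) \<le> 0" for j
    using deg_partial_deriv_le[OF assms] by simp
  then show ?thesis
    unfolding sos_convex_def by (intro exI[of _ 0]) (simp add: partial_deriv_deg_0)
qed

text \<open>The base point is chosen as \<open>L(x) / L 1\<close> so that L annihilates the linear
  part of the Taylor expansion; nonnegativity of L on the remainder is then the inequality.\<close>

lemma jensen_sos_convex:
  assumes L: "L \<in> dual_cone (cone_x d)" and L1: "0 < L 1"
    and h: "sos_convex h" "deg h \<le> 2 * d"
  shows "L 1 * eval h (\<chi> i. L (variable i) / L 1) \<le> L h"
proof -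
  define a :: "real ^ 'a" where "a = (\<chi> i. L (variable i) / L 1)"
  have lin: "linear L" using L by (simp add: dual_cone_def)
  have L_const: "L (const c) = c * L 1" for c
    using linear_cmul[OF lin, of c 1] by (simp add: scaleR_eq_const_mult)
  have "0 \<le> L (taylor_remainder a h)"
    using L taylor_remainder_sos[OF h(1)] deg_taylor_remainder_le[OF h(2)]
    by (auto simp: dual_cone_def cone_x_def)
  also have "L (taylor_remainder a h) = L h - eval h a * L 1 -
      (\<Sum>i\<in>UNIV. eval (partial_deriv i h) a * (L (variable i) - a $ i * L 1))"
    by (simp add: taylor_remainder_def linear_diff[OF lin] linear_sum[OF lin] L_const
        linear_cmul[OF lin] flip: scaleR_eq_const_mult)
  also have "\<dots> = L h - eval h a * L 1"
    using L1 by (simp add: a_def)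
  finally show ?thesis by (simp add: a_def mult.commute)
qed


section \<open>Nonnegative polynomials on an interval\<close>

definition sos_deg :: "nat \<Rightarrow> nat \<Rightarrow> 'v::finite mpoly set" where
  "sos_deg k N = {\<sigma>\<in>sos. \<sigma> = 0 \<or> deg \<sigma> + k \<le> N}"

lemma sos_deg_add: "a \<in> sos_deg k N \<Longrightarrow> b \<in> sos_deg k N \<Longrightarrow> a + b \<in> sos_deg k N"
  using deg_add_le[of a "max (deg a) (deg b)" b] by (auto simp: sos_deg_def sos_add)

lemma sos_deg_mono: "a \<in> sos_deg k N \<Longrightarrow> N + k' \<le> N' + k \<Longrightarrow> a \<in> sos_deg k' N'"
  by (auto simp: sos_deg_def)

lemma sos_deg_mult_square:
  assumes "a \<in> sos_deg k N" "deg l \<le> 1" shows "l\<^sup>2 * a \<in> sos_deg k (N + 2)"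
  using assms deg_mult_le[OF deg_power_le[OF assms(2), of 2] order_refl, of a]
  by (auto simp: sos_deg_def sos_mult_square)

lemma deg_const [simp]: "deg (const c) = 0"
  using deg_single_le[of 0 0] by simp

text \<open>Lukacs's representations, the first for even and the second for odd \<open>N\<close>; the univariate
  polynomial \<open>q\<close> is read in the variable \<open>u\<close>.\<close>

definition lukacs_even :: "'v::finite \<Rightarrow> nat \<Rightarrow> real poly \<Rightarrow> bool" where
  "lukacs_even u N q \<longleftrightarrow> (\<exists>\<sigma>\<in>sos_deg 0 N. \<exists>\<tau>\<in>sos_deg 2 N. \<forall>y.
     poly q (y $ u) = eval \<sigma> y + (1 - (y $ u)\<^sup>2) * eval \<tau> y)"

definition lukacs_odd :: "'v::finite \<Rightarrow> nat \<Rightarrow> real poly \<Rightarrow> bool" where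
  "lukacs_odd u N q \<longleftrightarrow> (\<exists>\<sigma>\<in>sos_deg 1 N. \<exists>\<tau>\<in>sos_deg 1 N. \<forall>y.
     poly q (y $ u) = (1 - y $ u) * eval \<sigma> y + (1 + y $ u) * eval \<tau> y)"

lemma lukacs_evenI:
  assumes "\<sigma> \<in> sos_deg 0 N" "\<tau> \<in> sos_deg 2 N"
    and "\<And>y. poly q (y $ u) = eval \<sigma> y + (1 - (y $ u)\<^sup>2) * eval \<tau> y"
  shows "lukacs_even u N q"
  using assms unfolding lukacs_even_def by blast

lemma lukacs_oddI:
  assumes "\<sigma> \<in> sos_deg 1 N" "\<tau> \<in> sos_deg 1 N"
    and "\<And>y. poly q (y $ u) = (1 - y $ u) * eval \<sigma> y + (1 + y $ u) * eval \<tau> y"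
  shows "lukacs_odd u N q"
  using assms unfolding lukacs_odd_def by blast

definition lukacs :: "'v::finite \<Rightarrow> nat \<Rightarrow> real poly \<Rightarrow> bool" where
  "lukacs u N q \<longleftrightarrow> (if even N then lukacs_even u N q else lukacs_odd u N q)"

lemma lukacs_add:
  assumes "lukacs u N p" "lukacs u N q" shows "lukacs u N (p + q)"
proof (cases "even N")
  case True
  then obtain \<sigma> \<tau> \<sigma>' \<tau>' where "\<sigma> \<in> sos_deg 0 N" "\<tau> \<in> sos_deg 2 N" "\<sigma>' \<in> sos_deg 0 N" "\<tau>' \<in> sos_deg 2 N"
    and "\<forall>y. poly p (y $ u) = eval \<sigma> y + (1 - (y $ u)\<^sup>2) * eval \<tau> y"
    and "\<forall>y. poly q (y $ u) = eval \<sigma>' y + (1 - (y $ u)\<^sup>2) * eval \<tau>' y"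
    using assms by (auto simp: lukacs_def lukacs_even_def)
  then have "lukacs_even u N (p + q)"
    by (intro lukacs_evenI[of "\<sigma> + \<sigma>'" _ "\<tau> + \<tau>'"] sos_deg_add)
      (simp_all add: eval_add distrib_left)
  with True show ?thesis by (simp add: lukacs_def)
next
  case False
  then obtain \<sigma> \<tau> \<sigma>' \<tau>' where "\<sigma> \<in> sos_deg 1 N" "\<tau> \<in> sos_deg 1 N" "\<sigma>' \<in> sos_deg 1 N" "\<tau>' \<in> sos_deg 1 N"
    and "\<forall>y. poly p (y $ u) = (1 - y $ u) * eval \<sigma> y + (1 + y $ u) * eval \<tau> y"
    and "\<forall>y. poly q (y $ u) = (1 - y $ u) * eval \<sigma>' y + (1 + y $ u) * eval \<tau>' y"
    using assms by (auto simp: lukacs_def lukacs_odd_def)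
  then have "lukacs_odd u N (p + q)"
    by (intro lukacs_oddI[of "\<sigma> + \<sigma>'" _ "\<tau> + \<tau>'"] sos_deg_add)
      (simp_all add: eval_add distrib_left)
  with False show ?thesis by (simp add: lukacs_def)
qed

lemma lukacs_const:
  assumes "0 \<le> c" shows "lukacs u N [:c:]"
proof (cases "even N")
  case True
  have "const c \<in> sos_deg 0 N" "0 \<in> sos_deg 2 N"
    using assms by (auto simp: sos_deg_def sos_const sos_0)
  then have "lukacs_even u N [:c:]"
    by (rule lukacs_evenI) (auto simp: eval_simps)
  with True show ?thesis by (simp add: lukacs_def)
next
  case False
  \<comment> \<open>The multipliers 1 - t and 1 + t add up to 2, hence the halves; N is odd, so N is
    at least 1.\<close>
  then have "const (c / 2) \<in> sos_deg 1 N"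
    using assms by (cases N) (auto simp: sos_deg_def sos_const)
  then have "lukacs_odd u N [:c:]"
    by (intro lukacs_oddI[of "const (c / 2)" _ "const (c / 2)"]) (auto simp: eval_simps field_simps)
  with False show ?thesis by (simp add: lukacs_def)
qed

lemma deg_affine_le:
  "deg (variable i - const c) \<le> 1" "deg (1 - variable i) \<le> 1" "deg (1 + variable i) \<le> 1"
proof -
  have "deg (1 :: 'a mpoly) \<le> 1" using deg_single_le[where \<alpha> = 0 and n = 1 and c = 1] by simp
  then show "deg (variable i - const c) \<le> 1" "deg (1 - variable i) \<le> 1" "deg (1 + variable i) \<le> 1"
    by (auto intro!: deg_diff_le deg_add_le deg_single_le simp: deg_variable_le[simplified])
qed

lemma lukacs_mult_square:
  assumes "lukacs u N q" shows "lukacs u (N + 2) ([:- a, 1:]\<^sup>2 * q)"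
proof (cases "even N")
  case True
  then obtain \<sigma> \<tau> where "\<sigma> \<in> sos_deg 0 N" "\<tau> \<in> sos_deg 2 N"
    and q: "\<forall>y. poly q (y $ u) = eval \<sigma> y + (1 - (y $ u)\<^sup>2) * eval \<tau> y"
    using assms by (auto simp: lukacs_def lukacs_even_def)
  then have "lukacs_even u (N + 2) ([:- a, 1:]\<^sup>2 * q)"
    by (intro lukacs_evenI[of "(variable u - const a)\<^sup>2 * \<sigma>" _ "(variable u - const a)\<^sup>2 * \<tau>"]
        sos_deg_mult_square deg_affine_le)
      (simp_all add: q eval_simps distrib_left distrib_right mult.left_commute power2_eq_square,
        simp_all add: algebra_simps)
  with True show ?thesis by (simp add: lukacs_def)
next
  case False
  then obtain \<sigma> \<tau> where "\<sigma> \<in> sos_deg 1 N" "\<tau> \<in> sos_deg 1 N"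
    and q: "\<forall>y. poly q (y $ u) = (1 - y $ u) * eval \<sigma> y + (1 + y $ u) * eval \<tau> y"
    using assms by (auto simp: lukacs_def lukacs_odd_def)
  then have "lukacs_odd u (N + 2) ([:- a, 1:]\<^sup>2 * q)"
    by (intro lukacs_oddI[of "(variable u - const a)\<^sup>2 * \<sigma>" _ "(variable u - const a)\<^sup>2 * \<tau>"]
        sos_deg_mult_square deg_affine_le)
      (simp_all add: q eval_simps distrib_left distrib_right mult.left_commute power2_eq_square,
        simp_all add: algebra_simps)
  with False show ?thesis by (simp add: lukacs_def)
qed

text \<open>A linear factor switches the parity. From even to odd, (1 - t)(1 - t^2) = (1 - t)^2 (1 +
  t); from odd to even, (1 - t)(1 + t) = 1 - t^2; likewise for 1 + t.\<close>

lemma lukacs_mult_linear: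
  assumes "lukacs u N q" shows "lukacs u (Suc N) ([:1, -1:] * q)" "lukacs u (Suc N) ([:1, 1:] * q)"
proof -
  have "lukacs u (Suc N) ([:1, -1:] * q) \<and> lukacs u (Suc N) ([:1, 1:] * q)"
  proof (cases "even N")
    case True
    then obtain \<sigma> \<tau> where *: "\<sigma> \<in> sos_deg 0 N" "\<tau> \<in> sos_deg 2 N"
      and q: "\<forall>y. poly q (y $ u) = eval \<sigma> y + (1 - (y $ u)\<^sup>2) * eval \<tau> y"
      using assms by (auto simp: lukacs_def lukacs_even_def)
    have 1: "\<sigma> \<in> sos_deg 1 (Suc N)" using *(1) by (rule sos_deg_mono) simp
    have 2: "l\<^sup>2 * \<tau> \<in> sos_deg 1 (Suc N)" if "deg l \<le> 1" for l
      using sos_deg_mult_square[OF *(2) that] by (rule sos_deg_mono) simp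
    have "lukacs_odd u (Suc N) ([:1, -1:] * q)"
      by (intro lukacs_oddI[OF 1 2[of "1 - variable u"]] deg_affine_le)
        (simp_all add: q eval_simps algebra_simps power2_eq_square)
    moreover have "lukacs_odd u (Suc N) ([:1, 1:] * q)"
      by (intro lukacs_oddI[OF 2[of "1 + variable u"] 1] deg_affine_le)
        (simp_all add: q eval_simps algebra_simps power2_eq_square)
    ultimately show ?thesis using True by (simp add: lukacs_def)
  next
    case False
    then obtain \<sigma> \<tau> where *: "\<sigma> \<in> sos_deg 1 N" "\<tau> \<in> sos_deg 1 N"
      and q: "\<forall>y. poly q (y $ u) = (1 - y $ u) * eval \<sigma> y + (1 + y $ u) * eval \<tau> y"
      using assms by (auto simp: lukacs_def lukacs_odd_def)
    have 1: "a \<in> sos_deg 2 (Suc N)" if "a \<in> sos_deg 1 N" for a :: "'a mpoly"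
      using that by (rule sos_deg_mono) simp
    have 2: "l\<^sup>2 * a \<in> sos_deg 0 (Suc N)" if "a \<in> sos_deg 1 N" "deg l \<le> 1" for l a :: "'a mpoly"
      using sos_deg_mult_square[OF that] by (rule sos_deg_mono) simp
    have "lukacs_even u (Suc N) ([:1, -1:] * q)"
      by (intro lukacs_evenI[OF 2[OF *(1), of "1 - variable u"] 1[OF *(2)]] deg_affine_le)
        (simp_all add: q eval_simps algebra_simps power2_eq_square)
    moreover have "lukacs_even u (Suc N) ([:1, 1:] * q)"
      by (intro lukacs_evenI[OF 2[OF *(2), of "1 + variable u"] 1[OF *(1)]] deg_affine_le)
        (simp_all add: q eval_simps algebra_simps power2_eq_square)
    ultimately show ?thesis using False by (simp add: lukacs_def)
  qed
  then show "lukacs u (Suc N) ([:1, -1:] * q)" "lukacs u (Suc N) ([:1, 1:] * q)" by auto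
qed

text \<open>Dividing a nonnegative polynomial by a factor vanishing at a fixes the sign of the
  quotient only away from a; continuity supplies the missing point.\<close>

lemma poly_nonneg_extend:
  fixes q :: "real poly"
  assumes "\<And>t. t \<in> {-1..1} \<Longrightarrow> t \<noteq> a \<Longrightarrow> 0 \<le> poly q t" and "t \<in> {-1..1}"
  shows "0 \<le> poly q t"
proof (cases "t = a")
  case True
  have "t islimpt {-1..1}" using assms(2) by simp
  then obtain X where X: "\<And>n. X n \<in> {-1..1} - {t}" "X \<longlonglongrightarrow> t"
    unfolding islimpt_sequential by blast
  have "(\<lambda>n. poly q (X n)) \<longlonglongrightarrow> poly q t"
    by (intro tendsto_intros X)
  then show ?thesis
    by (rule LIMSEQ_le_const) (use X(1) assms(1) True in auto)
qed (use assms in auto)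

text \<open>Subtracting the minimum produces a zero in the interval; it is a double zero unless it is an
  end point, so it can be split off together with a factor admitting a representation.\<close>

lemma nonneg_interval_lukacs:
  assumes "degree q \<le> N" and "\<And>t. t \<in> {-1..1} \<Longrightarrow> 0 \<le> poly q t"
  shows "lukacs u N q"
  using assms
proof (induction N arbitrary: q rule: less_induct)
  case (less N)
  have "continuous_on {-1..1} (poly q)" by (intro continuous_intros)
  then obtain a where a: "a \<in> {-1..1}" and min: "\<And>t. t \<in> {-1..1} \<Longrightarrow> poly q a \<le> poly q t"
    using continuous_attains_inf[of "{-1..1::real}" "poly q"] by auto
  define m where "m = poly q a"
  define p where "p = q - [:m:]"
  have m: "lukacs u N [:m:]" using less.prems(2)[OF a] by (intro lukacs_const) (simp add: m_def)
  have p_nonneg: "0 \<le> poly p t" if "t \<in> {-1..1}" for t using min[OF that] by (simp add: p_def m_def)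
  have deg_p: "degree p \<le> N"
    unfolding p_def using less.prems(1) by (intro degree_diff_le) auto
  have "lukacs u N p"
  proof (cases "p = 0")
    case True
    then show ?thesis using lukacs_const[of 0 u N] by simp
  next
    case False
    have "poly p a = 0" by (simp add: p_def m_def)
    then obtain r where r: "p = [:- a, 1:] * r" by (metis dvdE poly_eq_0_iff_dvd)
    have deg_r: "Suc (degree r) \<le> N"
      using deg_p False unfolding r by (subst (asm) degree_mult_eq) auto
    show ?thesis
    proof (cases "a \<in> {-1<..<1}")
      case False
      then have "a = 1 \<or> a = -1" using a by auto
      then show ?thesis
      proof
        assume [simp]: "a = 1"
        \<comment> \<open>The linear factor at this end point is 1 - t, so p = (1 - t) * (-
          r).\<close>
        have "0 \<le> poly (- r) t" if "t \<in> {-1..1}" for t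
        proof (rule poly_nonneg_extend[OF _ that, of 1])
          show "0 \<le> poly (- r) t" if "t \<in> {-1..1}" "t \<noteq> 1" for t
          proof -
            have "poly p t = (t - 1) * poly r t" by (simp add: r algebra_simps)
            then show ?thesis using p_nonneg[OF that(1)] that by (auto simp: zero_le_mult_iff)
          qed
        qed
        then have "lukacs u (N - 1) (- r)" using deg_r by (intro less.IH) auto
        from lukacs_mult_linear(1)[OF this] show ?thesis
          using deg_r by (simp add: r)
      next
        assume [simp]: "a = -1"
        have "0 \<le> poly r t" if "t \<in> {-1..1}" for t
        proof (rule poly_nonneg_extend[OF _ that, of "-1"])
          show "0 \<le> poly r t" if "t \<in> {-1..1}" "t \<noteq> -1" for t
          proof -
            have "poly p t = (t + 1) * poly r t" by (simp add: r algebra_simps)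
            then show ?thesis using p_nonneg[OF that(1)] that by (auto simp: zero_le_mult_iff)
          qed
        qed
        then have "lukacs u (N - 1) r" using deg_r by (intro less.IH) auto
        from lukacs_mult_linear(2)[OF this] show ?thesis
          using deg_r by (simp add: r)
      qed
    next
      case True
      \<comment> \<open>t - a changes sign at a while p does not, so r is nonnegative to the right
        of a and nonpositive to the left.\<close>
      have "poly r a = 0"
      proof -
        have "a islimpt {a<..<1}" "a islimpt {-1<..<a}" using True by (auto simp: islimpt_greaterThanLessThan1 islimpt_greaterThanLessThan2)
        then obtain X Z where X: "\<And>n. X n \<in> {a<..<1} - {a}" "X \<longlonglongrightarrow> a"
          and Z: "\<And>n. Z n \<in> {-1<..<a} - {a}" "Z \<longlonglongrightarrow> a"
          unfolding islimpt_sequential by blast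
        have "(\<lambda>n. poly r (X n)) \<longlonglongrightarrow> poly r a" "(\<lambda>n. poly r (Z n)) \<longlonglongrightarrow> poly r a"
          by (intro tendsto_intros X Z)+
        moreover have "0 \<le> poly r (X n)" "poly r (Z n) \<le> 0" for n
        proof -
          have "poly p t = (t - a) * poly r t" for t by (simp add: r algebra_simps)
          then show "0 \<le> poly r (X n)" "poly r (Z n) \<le> 0"
            using p_nonneg[of "X n"] p_nonneg[of "Z n"] X(1)[of n] Z(1)[of n] True
            by (auto simp: zero_le_mult_iff)
        qed
        ultimately show ?thesis
          by (meson LIMSEQ_le_const LIMSEQ_le_const2 order_antisym)
      qed
      then obtain s where s: "r = [:- a, 1:] * s" by (metis dvdE poly_eq_0_iff_dvd)
      then have p: "p = [:- a, 1:]\<^sup>2 * s" unfolding r s by (simp only: power2_eq_square mult.assoc)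
      have deg_s: "Suc (Suc (degree s)) \<le> N"
        using deg_r False unfolding r s by (subst (asm) (1) degree_mult_eq) auto
      have "0 \<le> poly s t" if "t \<in> {-1..1}" for t
      proof (rule poly_nonneg_extend[OF _ that, of a])
        show "0 \<le> poly s t" if "t \<in> {-1..1}" "t \<noteq> a" for t
        proof -
          have "poly p t = (t - a)\<^sup>2 * poly s t" unfolding p by (simp add: poly_power)
          then show ?thesis using p_nonneg[OF that(1)] that by (auto simp: zero_le_mult_iff)
        qed
      qed
      then have "lukacs u (N - 2) s" using deg_s by (intro less.IH) auto
      moreover have "N - 2 + 2 = N" using deg_s by simp
      ultimately show ?thesis using lukacs_mult_square[of u "N - 2" s a] by (simp only: p)
    qed
  qed
  from lukacs_add[OF this m] show ?case by (simp add: p_def)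
qed

lemma univariate_eval:
  fixes h :: "'n::finite mpoly"
  assumes "(UNIV :: 'n set) = {u}" "deg h \<le> N"
  shows "\<exists>q. degree q \<le> N \<and> (\<forall>y. eval h y = poly q (y $ u))"
  using assms(2)
proof (induction rule: deg_keys_induct)
  case zero
  show ?case by (rule exI[of _ 0]) (simp add: eval_0)
next
  case (monomial \<alpha> c)
  then have "Poly_Mapping.lookup \<alpha> u \<le> N" by (simp add: monomial_degree_def assms(1))
  then show ?case
    by (intro exI[of _ "monom c (Poly_Mapping.lookup \<alpha> u)"] conjI order_trans[OF degree_monom_le])
      (simp_all add: eval_single assms(1) poly_monom)
next
  case (add a b)
  then obtain p q where "degree p \<le> N" "\<forall>y. eval a y = poly p (y $ u)"
    "degree q \<le> N" "\<forall>y. eval b y = poly q (y $ u)" by blast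
  then show ?case by (intro exI[of _ "p + q"]) (auto simp: eval_add intro: degree_add_le)
qed

text \<open>The degree bound of the cone is dy rounded up to an even number N, so the even
  representation applies, and it has exactly the shape of the cone.\<close>

lemma nonneg_in_cone_y_interval:
  fixes q :: "'n::finite mpoly"
  assumes "CARD('n) = 1" and "deg q \<le> dy" and "\<And>y. (\<forall>i. y $ i \<in> {-1..1}) \<Longrightarrow> 0 \<le> eval q y"
  shows "q \<in> cone_y_interval dy"
proof -
  obtain u :: 'n where u: "(UNIV :: 'n set) = {u}" using assms(1) by (auto simp: card_1_singleton_iff)
  define N where "N = 2 * nat \<lceil>real dy / 2\<rceil>"
  have dyN: "dy \<le> N" unfolding N_def by linarith
  obtain p where p: "degree p \<le> dy" "\<And>y. eval q y = poly p (y $ u)"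
    using univariate_eval[OF u assms(2)] by blast
  have "0 \<le> poly p t" if "t \<in> {-1..1}" for t
    using assms(3)[of "\<chi> i. t"] that by (simp add: p)
  then have "lukacs u N p" using p(1) dyN by (intro nonneg_interval_lukacs) auto
  then obtain \<sigma> \<tau> where *: "\<sigma> \<in> sos_deg 0 N" "\<tau> \<in> sos_deg 2 N"
    and eq: "\<And>y. poly p (y $ u) = eval \<sigma> y + (1 - (y $ u)\<^sup>2) * eval \<tau> y"
    by (auto simp: lukacs_def lukacs_even_def N_def)
  define w :: "'n mpoly" where "w = 1 - variable u ^ 2"
  have "q = \<sigma> + \<tau> * w"
    by (rule eval_inject) (simp add: p eq w_def eval_simps)
  moreover have "deg (\<tau> * w) \<le> N"
  proof (cases "\<tau> = 0")
    case False
    have "deg w \<le> 2"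
      unfolding w_def
      using deg_power_le[OF deg_variable_le, of u 2] deg_single_le[where \<alpha> = 0 and n = 2 and c = 1] by (intro deg_diff_le) auto
    from deg_mult_le[OF order_refl this, of \<tau>] show ?thesis
      using *(2) False by (simp add: sos_deg_def)
  qed simp
  moreover have "\<sigma> \<in> sos" "\<tau> \<in> sos" "deg \<sigma> \<le> N" using * by (auto simp: sos_deg_def)
  ultimately show ?thesis
    unfolding cone_y_interval_def Let_def N_def[symmetric] u the_elem_eq w_def[symmetric] by blast
qed


section \<open>Nonnegative quadratic polynomials on an ellipsoid\<close>

lemma deg_0_eval: "deg h \<le> 0 \<Longrightarrow> eval h x = eval h y"
proof (induction rule: deg_keys_induct)
  case (monomial \<alpha> c)
  then show ?case by (simp add: eval_single monomial_degree_def)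
qed (simp_all add: eval_simps)

definition gradient :: "'v::finite mpoly \<Rightarrow> real ^ 'v \<Rightarrow> real ^ 'v" where
  "gradient h x = (\<chi> i. eval (partial_deriv i h) x)"

text \<open>Only meant for degree at most 2, where the second derivatives do not depend on the point.\<close>

definition hessian_form :: "'v::finite mpoly \<Rightarrow> real ^ 'v \<Rightarrow> real" where
  "hessian_form h d =
    (\<Sum>i\<in>UNIV. \<Sum>j\<in>UNIV. eval (partial_deriv j (partial_deriv i h)) 0 / 2 * (d $ i * d $ j))"

text \<open>In degree at most 2 the second derivative along a line is the constant 2Q, so
  subtracting t^2 Q leaves an affine function of t.\<close>

lemma quadratic_expansion:
  assumes "deg h \<le> 2"
  shows "eval h (y + d) = eval h y + gradient h y \<bullet> d + hessian_form h d"
proof -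
  define Q where "Q = hessian_form h d"
  define G where "G t = eval h (y + t *\<^sub>R d) - t\<^sup>2 * Q" for t
  define G' where "G' t = (\<Sum>i\<in>UNIV. eval (partial_deriv i h) (y + t *\<^sub>R d) * d $ i) - 2 * t * Q" for t
  have "(G has_real_derivative G' t) (at t)" for t
    unfolding G_def G'_def
    by (intro DERIV_diff DERIV_eval_line) (auto intro!: derivative_eq_intros)
  moreover have "(G' has_real_derivative 0) (at t)" for t
  proof -
    have "(G' has_real_derivative
      (\<Sum>i\<in>UNIV. (\<Sum>j\<in>UNIV. eval (partial_deriv j (partial_deriv i h)) (y + t *\<^sub>R d) * d $ j) * d $ i) - 2 * Q) (at t)"
      unfolding G'_def
      by (intro DERIV_diff DERIV_sum DERIV_cmult_right DERIV_eval_line) (auto intro!: derivative_eq_intros)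
    moreover have "eval (partial_deriv j (partial_deriv i h)) (y + t *\<^sub>R d) =
        eval (partial_deriv j (partial_deriv i h)) 0" for i j
      by (intro deg_0_eval) (use deg_partial_deriv_le[OF deg_partial_deriv_le[OF assms], of j i] in simp)
    ultimately show ?thesis
      by (simp add: Q_def hessian_form_def sum_distrib_left sum_distrib_right algebra_simps)
  qed
  ultimately have "G 1 = G 0 + G' 0" by (rule eq_line_of_second_deriv_0)
  then show ?thesis by (simp add: G_def G'_def Q_def gradient_def inner_vec_def)
qed

lemma hessian_form_scaleR: "hessian_form h (t *\<^sub>R d) = t\<^sup>2 * hessian_form h d"
  by (simp add: hessian_form_def sum_distrib_left power2_eq_square algebra_simps)

lemma hessian_form_minus: "hessian_form h (- d) = hessian_form h d"
  by (simp add: hessian_form_def)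

lemma quadratic_expansion_line:
  assumes "deg h \<le> 2"
  shows "eval h (y + t *\<^sub>R d) = eval h y + t * (gradient h y \<bullet> d) + t\<^sup>2 * hessian_form h d"
  using quadratic_expansion[OF assms, of y "t *\<^sub>R d"] by (simp add: hessian_form_scaleR)

text \<open>Read with e, a, b as value, slope and curvature of the constraint, these are directions
  that stay feasible for small steps: from an interior point any direction, from a boundary point
  those pointing inward.\<close>

lemma eventually_quadratic_pos:
  assumes "0 < e \<or> e = 0 \<and> 0 < a"
  shows "\<forall>\<^sub>F t in at_right (0::real). 0 < e + t * a + t\<^sup>2 * b"
  using assms
proof
  assume e: "0 < e"
  have "((\<lambda>t. e + t * a + t\<^sup>2 * b) \<longlongrightarrow> e + 0 * a + 0\<^sup>2 * b) (at_right 0)"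
    by (intro tendsto_intros)
  then show ?thesis using e by (intro order_tendstoD(1)) simp_all
next
  assume a: "e = 0 \<and> 0 < a"
  have "((\<lambda>t. a + t * b) \<longlongrightarrow> a + 0 * b) (at_right 0)"
    by (intro tendsto_intros)
  then have "\<forall>\<^sub>F t in at_right 0. 0 < a + t * b" 
    using a order_tendstoD(1)[of _ a _ 0] by simp
  moreover have "\<forall>\<^sub>F t in at_right (0::real). 0 < t" by (simp add: eventually_at_right_less)
  ultimately show ?thesis
  proof eventually_elim
    case (elim t)
    then have "0 < t * (a + t * b)" by simp
    with a show ?case by (simp add: algebra_simps power2_eq_square)
  qed
qed

lemma slope_nonneg_of_eventually:
  assumes "\<forall>\<^sub>F t in at_right (0::real). 0 \<le> t * g + t\<^sup>2 * Q"
  shows "0 \<le> g"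
proof -
  have "((\<lambda>t. g + t * Q) \<longlongrightarrow> g + 0 * Q) (at_right 0)"
    by (intro tendsto_intros)
  moreover have "\<forall>\<^sub>F t in at_right (0::real). 0 \<le> g + t * Q"
    using assms eventually_at_right_less[of 0]
  proof eventually_elim
    case (elim t)
    then have "0 \<le> t * (g + t * Q)" by (simp add: algebra_simps power2_eq_square)
    with elim show ?case by (simp add: zero_le_mult_iff)
  qed
  ultimately show ?thesis by (auto intro: tendsto_lowerbound)
qed

text \<open>Let r be the component of b orthogonal to a. The premise concerns only strictly positive
  products, so it is tested on \<epsilon> a - r, and \<epsilon> tending to 0 gives r = 0.\<close>

lemma farkas_single:
  fixes a b :: "'a::real_inner"
  assumes "a \<noteq> 0" and "\<And>d. 0 < a \<bullet> d \<Longrightarrow> 0 \<le> b \<bullet> d"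
  shows "\<exists>\<kappa>\<ge>0. b = \<kappa> *\<^sub>R a"
proof -
  define \<kappa> where "\<kappa> = (b \<bullet> a) / (a \<bullet> a)"
  define r where "r = b - \<kappa> *\<^sub>R a"
  have a: "0 < a \<bullet> a" using assms(1) by simp
  have ra: "a \<bullet> r = 0" using a by (simp add: r_def \<kappa>_def inner_diff_right inner_commute)
  have br: "b \<bullet> r = r \<bullet> r"
  proof -
    have "b = r + \<kappa> *\<^sub>R a" by (simp add: r_def)
    then show ?thesis using ra by (metis add.right_neutral inner_add_left inner_scaleR_left mult_zero_right)
  qed
  have "0 \<le> - (r \<bullet> r) + \<epsilon> * (b \<bullet> a)" if "0 < \<epsilon>" for \<epsilon>
  proof -
    have "0 < a \<bullet> (\<epsilon> *\<^sub>R a - r)" using a ra that by (simp add: inner_diff_right)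
    from assms(2)[OF this] show ?thesis by (simp add: inner_diff_right br)
  qed
  then have ev: "\<forall>\<^sub>F \<epsilon> in at_right 0. 0 \<le> - (r \<bullet> r) + \<epsilon> * (b \<bullet> a)"
    using eventually_at_right_less[of "0::real"] by (auto elim: eventually_mono)
  have tends: "((\<lambda>\<epsilon>. - (r \<bullet> r) + \<epsilon> * (b \<bullet> a)) \<longlongrightarrow> - (r \<bullet> r) + 0 * (b \<bullet> a)) (at_right 0)"
    by (intro tendsto_intros)
  have "0 \<le> - (r \<bullet> r) + 0 * (b \<bullet> a)" by (rule tendsto_lowerbound[OF tends ev]) simp
  then have "r \<bullet> r = 0" using inner_ge_zero[of r] by linarith
  then have "r = 0" by simp
  moreover have "0 \<le> \<kappa>" using a assms(2)[of a] by (simp add: \<kappa>_def)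
  ultimately show ?thesis by (auto simp: r_def)
qed

text \<open>This uses compactness of the superlevel set: otherwise a half-line would stay inside it.\<close>

lemma hessian_form_neg:
  assumes "deg \<phi> \<le> 2" "bounded {y. 0 \<le> eval \<phi> y}" "0 \<le> eval \<phi> y" "d \<noteq> 0"
  shows "hessian_form \<phi> d < 0"
proof (rule ccontr)
  assume "\<not> ?thesis"
  moreover define e where "e = (if 0 \<le> gradient \<phi> y \<bullet> d then d else - d)"
  ultimately have e: "0 \<le> gradient \<phi> y \<bullet> e" "0 \<le> hessian_form \<phi> e" "e \<noteq> 0"
    using assms(4) by (auto simp: hessian_form_minus)
  obtain B where B: "\<And>z. 0 \<le> eval \<phi> z \<Longrightarrow> norm z \<le> B"
    using assms(2) by (auto simp: bounded_iff)
  define t where "t = (B + norm y + 1) / norm e"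
  have "0 \<le> B" using B[OF assms(3)] norm_ge_zero order_trans by blast
  then have t: "0 \<le> t" "norm (t *\<^sub>R e) = B + norm y + 1" using e(3) by (auto simp: t_def)
  have "0 \<le> eval \<phi> (y + t *\<^sub>R e)"
    using e t assms(3) by (simp add: quadratic_expansion_line[OF assms(1)])
  from B[OF this] t(2) show False
    using norm_diff_ineq[of "t *\<^sub>R e" y] by (simp add: add.commute)
qed

text \<open>Optimality conditions of the trust region problem: at a minimizer \<open>z\<close> of \<open>q\<close> on the ellipsoid, the
  Lagrangian \<open>q - \<kappa> \<phi>\<close> is stationary. On a line through \<open>z\<close> meeting the boundary in a second
  point it therefore cannot be strictly concave, and almost every line through \<open>z\<close> is of this kind.\<close>

lemma trust_region_multiplier:
  assumes deg: "deg \<phi> \<le> 2" "deg q \<le> 2" and bdd: "bounded {y. 0 \<le> eval \<phi> y}"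
    and slater: "0 < eval \<phi> y0"
    and z: "0 \<le> eval \<phi> z" "\<And>y. 0 \<le> eval \<phi> y \<Longrightarrow> eval q z \<le> eval q y"
  shows "\<exists>\<kappa>\<ge>0. \<forall>d. eval q (z + d) - \<kappa> * eval \<phi> (z + d) =
      eval q z + (hessian_form q d - \<kappa> * hessian_form \<phi> d) \<and>
      0 \<le> hessian_form q d - \<kappa> * hessian_form \<phi> d"
proof (cases "eval \<phi> z = 0")
  \<comment> \<open>An interior minimizer satisfies the unconstrained first and second order
    conditions, with \<kappa> = 0.\<close>
  case False
  then have pos: "0 < eval \<phi> z" using z(1) by simp
  have ev: "\<forall>\<^sub>F t in at_right 0. 0 \<le> t * (gradient q z \<bullet> d) + t\<^sup>2 * hessian_form q d" for d
    using eventually_quadratic_pos[of "eval \<phi> z" "gradient \<phi> z \<bullet> d" "hessian_form \<phi> d"] pos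
  proof (rule_tac eventually_mono)
    fix t assume "0 < eval \<phi> z + t * (gradient \<phi> z \<bullet> d) + t\<^sup>2 * hessian_form \<phi> d"
    then have "0 \<le> eval \<phi> (z + t *\<^sub>R d)" by (simp add: quadratic_expansion_line[OF deg(1)])
    from z(2)[OF this] show "0 \<le> t * (gradient q z \<bullet> d) + t\<^sup>2 * hessian_form q d"
      by (simp add: quadratic_expansion_line[OF deg(2)])
  qed auto
  have g0: "gradient q z \<bullet> d = 0" for d
    using slope_nonneg_of_eventually[OF ev[of d]] slope_nonneg_of_eventually[OF ev[of "- d"]] by simp
  have "0 \<le> hessian_form q d" for d
  proof -
    have "\<forall>\<^sub>F t in at_right 0. 0 < t \<and> 0 \<le> t\<^sup>2 * hessian_form q d"
      using ev[of d] eventually_at_right_less[of "0::real"] by eventually_elim (simp add: g0)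
    then obtain t where "0 < t" "0 \<le> t\<^sup>2 * hessian_form q d"
      using eventually_happens'[OF trivial_limit_at_right_real] by blast
    then show ?thesis by (simp add: zero_le_mult_iff)
  qed
  then show ?thesis
    by (intro exI[of _ 0]) (simp add: quadratic_expansion[OF deg(2)] g0)
next
  case True
  let ?g = "gradient \<phi> z"
  have neg: "hessian_form \<phi> d < 0" if "d \<noteq> 0" for d
    using hessian_form_neg[OF deg(1) bdd _ that] slater by (meson less_imp_le)
  have "y0 \<noteq> z" using True slater by auto
  \<comment> \<open>The Hessian term is negative and the value at the Slater point positive, so the
    linear term must be positive. This rules out a vanishing constraint gradient.\<close>
  then have "0 < ?g \<bullet> (y0 - z)"
    using quadratic_expansion[OF deg(1), of z "y0 - z"] slater True neg[of "y0 - z"] by simp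
  then have g: "?g \<noteq> 0" by auto
  have "0 \<le> gradient q z \<bullet> d" if d: "0 < ?g \<bullet> d" for d
  proof -
    have "\<forall>\<^sub>F t in at_right 0. 0 \<le> t * (gradient q z \<bullet> d) + t\<^sup>2 * hessian_form q d"
      using eventually_quadratic_pos[of "eval \<phi> z" "gradient \<phi> z \<bullet> d" "hessian_form \<phi> d"] d True
    proof (rule_tac eventually_mono)
      fix t assume "0 < eval \<phi> z + t * (gradient \<phi> z \<bullet> d) + t\<^sup>2 * hessian_form \<phi> d"
      then have "0 \<le> eval \<phi> (z + t *\<^sub>R d)" by (simp add: quadratic_expansion_line[OF deg(1)])
      from z(2)[OF this] show "0 \<le> t * (gradient q z \<bullet> d) + t\<^sup>2 * hessian_form q d"
        by (simp add: quadratic_expansion_line[OF deg(2)])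
    qed auto
    then show ?thesis by (rule slope_nonneg_of_eventually)
  qed
  from farkas_single[OF g this] obtain \<kappa> where \<kappa>: "0 \<le> \<kappa>" "gradient q z = \<kappa> *\<^sub>R ?g" by blast
  define M where "M d = hessian_form q d - \<kappa> * hessian_form \<phi> d" for d
  have eq: "eval q (z + d) - \<kappa> * eval \<phi> (z + d) = eval q z + M d" for d
    using quadratic_expansion[OF deg(1), of z d] quadratic_expansion[OF deg(2), of z d]
    by (simp add: M_def \<kappa>(2) True algebra_simps)
  have M_generic: "0 \<le> M d" if d: "?g \<bullet> d \<noteq> 0" for d
  proof -
    have "d \<noteq> 0" using d by auto
    then have n: "hessian_form \<phi> d < 0" by (rule neg)
    \<comment> \<open>The second root of the quadratic
      \<open>eval \<phi> (z + t *\<^sub>R d)\<close>, nonzero because d is not tangent to the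
      boundary.\<close>
    define t where "t = - (?g \<bullet> d) / hessian_form \<phi> d"
    have t: "t \<noteq> 0" "t * (?g \<bullet> d) + t\<^sup>2 * hessian_form \<phi> d = 0"
      using d n by (auto simp: t_def power2_eq_square field_simps)
    then have *: "eval \<phi> (z + t *\<^sub>R d) = 0"
      by (simp add: quadratic_expansion_line[OF deg(1)] True)
    have "M (t *\<^sub>R d) = t\<^sup>2 * M d" by (simp add: M_def hessian_form_scaleR algebra_simps)
    moreover have "0 \<le> M (t *\<^sub>R d)"
      using eq[of "t *\<^sub>R d"] z(2)[of "z + t *\<^sub>R d"] * by simp
    ultimately show ?thesis using t(1) by (simp add: zero_le_mult_iff)
  qed
  have "0 \<le> M d" for d
  proof (cases "?g \<bullet> d = 0")
    case True
    \<comment> \<open>A tangential direction is the limit of the transversal directions d +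
      \<epsilon> ?g.\<close>
    have "isCont (\<lambda>\<epsilon>. M (d + \<epsilon> *\<^sub>R ?g)) 0"
      unfolding M_def hessian_form_def by (intro continuous_intros)
    then have "((\<lambda>\<epsilon>. M (d + \<epsilon> *\<^sub>R ?g)) \<longlongrightarrow> M (d + 0 *\<^sub>R ?g)) (at_right 0)"
      unfolding isCont_def by (rule tendsto_mono[OF at_le, rotated]) simp
    moreover have "\<forall>\<^sub>F \<epsilon> in at_right 0. 0 \<le> M (d + \<epsilon> *\<^sub>R ?g)"
      using eventually_at_right_less[of "0::real"]
      by eventually_elim (use g True in \<open>auto intro!: M_generic simp: inner_add_right\<close>)
    ultimately have "0 \<le> M (d + 0 *\<^sub>R ?g)" by (auto intro: tendsto_lowerbound)
    then show ?thesis by simp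
  qed (rule M_generic)
  with eq \<kappa>(1) show ?thesis unfolding M_def by blast
qed

text \<open>At a minimizer z with multiplier \<kappa>, the polynomial q - \<kappa> \<phi> is the
  nonnegative constant \<open>eval q z\<close> plus a positive semidefinite form in y - z, hence a
  sum of squares.\<close>

lemma nonneg_in_cone_y_quadratic:
  assumes "compact {y. 0 \<le> eval \<phi> y}" "deg \<phi> \<le> 2" "0 < eval \<phi> y0"
    and "deg q \<le> 2" and nonneg: "\<And>y. 0 \<le> eval \<phi> y \<Longrightarrow> 0 \<le> eval q y"
  shows "q \<in> cone_y_quadratic \<phi>"
proof -
  have "{y. 0 \<le> eval \<phi> y} \<noteq> {}" using assms(3) less_imp_le by blast
  then obtain z where z: "0 \<le> eval \<phi> z" "\<And>y. 0 \<le> eval \<phi> y \<Longrightarrow> eval q z \<le> eval q y"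
    using continuous_attains_inf[OF assms(1) _ continuous_on_eval[of _ q]] by auto
  obtain \<kappa> where \<kappa>: "0 \<le> \<kappa>"
    and eq: "\<And>d. eval q (z + d) - \<kappa> * eval \<phi> (z + d) =
      eval q z + (hessian_form q d - \<kappa> * hessian_form \<phi> d)"
    and psd: "\<And>d. 0 \<le> hessian_form q d - \<kappa> * hessian_form \<phi> d"
    using trust_region_multiplier[OF assms(2,4) compact_imp_bounded[OF assms(1)] assms(3) z] by blast
  define C where "C i j = eval (partial_deriv j (partial_deriv i q)) 0 -
      \<kappa> * eval (partial_deriv j (partial_deriv i \<phi>)) 0" for i j
  \<comment> \<open>The divisor 4 combines the 1/2 of the second-order Taylor term with the 1/2 of
    symmetrization; symmetry is required for completing squares.\<close>
  define B where "B i j = (C i j + C j i) / 4" for i j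
  have B: "(\<Sum>i\<in>UNIV. \<Sum>j\<in>UNIV. B i j * (d $ i * d $ j)) =
      hessian_form q d - \<kappa> * hessian_form \<phi> d" for d
  proof -
    have "(\<Sum>i\<in>UNIV. \<Sum>j\<in>UNIV. C j i * (d $ i * d $ j)) = (\<Sum>i\<in>UNIV. \<Sum>j\<in>UNIV. C i j * (d $ i * d $ j))"
      by (subst sum.swap) (simp add: mult.commute)
    moreover have "(\<Sum>i\<in>UNIV. \<Sum>j\<in>UNIV. B i j * (d $ i * d $ j)) =
        ((\<Sum>i\<in>UNIV. \<Sum>j\<in>UNIV. C i j * (d $ i * d $ j)) + (\<Sum>i\<in>UNIV. \<Sum>j\<in>UNIV. C j i * (d $ i * d $ j))) / 4"
      by (simp add: B_def sum_divide_distrib sum.distrib add_divide_distrib distrib_right)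
    moreover have "(\<Sum>i\<in>UNIV. \<Sum>j\<in>UNIV. C i j * (d $ i * d $ j)) =
        2 * (hessian_form q d - \<kappa> * hessian_form \<phi> d)"
      by (simp add: C_def hessian_form_def sum_subtractf sum_distrib_left left_diff_distrib
          right_diff_distrib mult.assoc)
    ultimately show ?thesis by simp
  qed
  define \<theta> where "\<theta> = q - \<kappa> *\<^sub>R \<phi>"
  have "\<theta> = const (eval q z) + (\<Sum>i\<in>UNIV. \<Sum>j\<in>UNIV.
      const (B i j) * ((variable i - const (z $ i)) * (variable j - const (z $ j))))"
  proof (rule eval_inject)
    fix y
    show "eval \<theta> y = eval (const (eval q z) + (\<Sum>i\<in>UNIV. \<Sum>j\<in>UNIV.
      const (B i j) * ((variable i - const (z $ i)) * (variable j - const (z $ j))))) y"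
      using eq[of "y - z"] B[of "y - z"] by (simp add: \<theta>_def eval_simps)
  qed
  moreover have "(\<Sum>i\<in>UNIV. \<Sum>j\<in>UNIV.
      const (B i j) * ((variable i - const (z $ i)) * (variable j - const (z $ j)))) \<in> sos"
  proof (rule psd_form_sos)
    show "0 \<le> (\<Sum>i\<in>UNIV. \<Sum>j\<in>UNIV. B i j * (c i * c j))" for c
      using psd[of "\<chi> i. c i"] B[of "\<chi> i. c i"] by simp
  qed (simp_all add: B_def add.commute)
  ultimately have "\<theta> \<in> sos" using nonneg[OF z(1)] by (auto intro: sos_add sos_const)
  moreover have "deg \<theta> \<le> 2"
    unfolding \<theta>_def using assms by (intro deg_diff_le deg_scaleR_le)
  moreover have "q = \<theta> + \<kappa> *\<^sub>R \<phi>" by (simp add: \<theta>_def)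
  ultimately show ?thesis using \<kappa> unfolding cone_y_quadratic_def by blast
qed


section \<open>Polynomials in two groups of variables\<close>

lemma apply_x_single:
  "apply_x L (Poly_Mapping.single (\<alpha>, \<beta>) c) = Poly_Mapping.single \<beta> (c * L (monomial \<alpha>))"
  by (simp add: apply_x_def)

lemma apply_y_single:
  "apply_y H (Poly_Mapping.single (\<alpha>, \<beta>) c) = Poly_Mapping.single \<alpha> (c * H (monomial \<beta>))"
  by (simp add: apply_y_def)

lemmas apply_x_simps = linear_0[OF linear_apply_x] linear_add[OF linear_apply_x] apply_x_single
  and apply_y_simps = linear_0[OF linear_apply_y] linear_add[OF linear_apply_y] apply_y_single

text \<open>Fubini's theorem for a pair of functionals, checked on monomials. It is applied with
  evaluation, differentiation at a point and integration in the two roles.\<close>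

lemma apply_swap:
  assumes L: "linear L" and H: "linear H"
  shows "L (apply_y H p) = H (apply_x L p)"
proof (induction p rule: mpoly_induct)
  case (single k c)
  obtain \<alpha> \<beta> where k: "k = (\<alpha>, \<beta>)" by (cases k)
  show ?case
    unfolding k apply_x_single apply_y_single single_eq_scaleR_monomial
    by (simp add: linear_cmul[OF L] linear_cmul[OF H])
qed (simp_all add: apply_x_simps apply_y_simps linear_0[OF L] linear_0[OF H]
    linear_add[OF L] linear_add[OF H])

lemma eval_apply_x: "linear L \<Longrightarrow> eval (apply_x L p) y = L (at_y p y)"
  unfolding at_y_def by (rule apply_swap[OF _ linear_eval, symmetric])

lemma apply_y_atomic:
  "apply_y (\<lambda>q. \<Sum>k\<in>S. w k * eval q (z k)) p = (\<Sum>k\<in>S. w k *\<^sub>R at_y p (z k))"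
proof (induction p rule: mpoly_induct)
  case (single k c)
  obtain \<alpha> \<beta> where k: "k = (\<alpha>, \<beta>)" by (cases k)
  show ?case
    unfolding k at_y_def apply_y_single single_eq_scaleR_monomial[of \<alpha>]
    by (simp add: sum_distrib_left scaleR_sum_left algebra_simps)
qed (simp_all add: at_y_def apply_y_simps scaleR_add_right sum.distrib)

lemma deg_apply_x_le: "deg (apply_x L p) \<le> deg_y p"
  unfolding apply_x_def
proof (rule deg_sum_le, clarify)
  fix \<alpha> \<beta> assume "(\<alpha>, \<beta>) \<in> Poly_Mapping.keys p"
  then have "monomial_degree \<beta> \<le> deg_y p"
    unfolding deg_y_def by (intro Max_ge) (auto intro: rev_image_eqI)
  then show "deg (Poly_Mapping.single \<beta> (Poly_Mapping.lookup p (\<alpha>, \<beta>) * L (monomial \<alpha>))) \<le> deg_y p"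
    by (rule deg_single_le)
qed

lemma deg_apply_y_le: "deg (apply_y H p) \<le> deg_x p"
  unfolding apply_y_def
proof (rule deg_sum_le, clarify)
  fix \<alpha> \<beta> assume "(\<alpha>, \<beta>) \<in> Poly_Mapping.keys p"
  then have "monomial_degree \<alpha> \<le> deg_x p"
    unfolding deg_x_def by (intro Max_ge) (auto intro: rev_image_eqI)
  then show "deg (Poly_Mapping.single \<alpha> (Poly_Mapping.lookup p (\<alpha>, \<beta>) * H (monomial \<beta>))) \<le> deg_x p"
    by (rule deg_single_le)
qed


section \<open>Atomic representation of an integral\<close>

lemma AE_compact_integrable:
  fixes G :: "'a::euclidean_space \<Rightarrow> 'b::euclidean_space"
  assumes "finite_measure \<mu>" "sets \<mu> = sets borel" "compact Y" "AE y in \<mu>. y \<in> Y"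
    and "continuous_on UNIV G"
  shows "integrable \<mu> G"
proof -
  obtain B where B: "\<And>y. y \<in> Y \<Longrightarrow> norm (G y) \<le> B"
    using compact_imp_bounded[OF compact_continuous_image[OF continuous_on_subset[OF assms(5)] assms(3)]]
    by (auto simp: bounded_iff)
  show ?thesis
  proof (rule finite_measure.integrable_const_bound[OF assms(1)])
    show "AE y in \<mu>. norm (G y) \<le> B" using assms(4) by eventually_elim (rule B)
    show "G \<in> borel_measurable \<mu>"
      using borel_measurable_continuous_onI[OF assms(5)] measurable_cong_sets[OF assms(2) refl] by blast
  qed
qed

lemma integral_in_convex_cone:
  fixes G :: "'a::euclidean_space \<Rightarrow> 'b::euclidean_space"
  assumes \<mu>: "finite_measure \<mu>" "sets \<mu> = sets borel" and Y: "compact Y" "AE y in \<mu>. y \<in> Y"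
    and G: "continuous_on UNIV G"
  shows "\<exists>(S :: 'b set) w z. finite S \<and> (\<forall>v\<in>S. 0 \<le> w v \<and> z v \<in> Y) \<and>
    integral\<^sup>L \<mu> G = (\<Sum>v\<in>S. w v *\<^sub>R G (z v))"
proof (cases "measure \<mu> (space \<mu>) = 0")
  case True
  then have "AE y in \<mu>. False"
    using \<mu>(1) by (simp add: AE_iff_null null_sets_def finite_measure.emeasure_eq_measure)
  then have "integral\<^sup>L \<mu> G = 0" by (intro integral_eq_zero_AE) auto
  then show ?thesis by (intro exI[of _ "{}"]) simp
next
  case False
  define m where "m = measure \<mu> (space \<mu>)"
  have m: "0 < m" using False by (simp add: m_def less_le)
  define c where "c = (1 / m) *\<^sub>R integral\<^sup>L \<mu> G"
  have int: "integrable \<mu> G" using \<mu> Y G by (rule AE_compact_integrable)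
  have "compact (convex hull (G ` Y))"
    by (intro compact_convex_hull compact_continuous_image Y(1) continuous_on_subset[OF G]) simp
  then have closed: "closed (convex hull (G ` Y))" by (rule compact_imp_closed)
  have "c \<in> convex hull (G ` Y)"
  proof (rule ccontr)
    assume "c \<notin> convex hull (G ` Y)"
    then obtain a b where ab: "a \<bullet> c < b" "\<And>x. x \<in> convex hull (G ` Y) \<Longrightarrow> b < a \<bullet> x"
      using separating_hyperplane_closed_point[OF convex_convex_hull closed] by blast
    have "integral\<^sup>L \<mu> (\<lambda>y. b) \<le> integral\<^sup>L \<mu> (\<lambda>y. a \<bullet> G y)"
    proof (rule integral_mono_AE)
      show "integrable \<mu> (\<lambda>y. b)" using \<mu>(1) by (simp add: finite_measure.integrable_const)
      show "integrable \<mu> (\<lambda>y. a \<bullet> G y)" using int by simp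
      show "AE y in \<mu>. b \<le> a \<bullet> G y"
        using Y(2) by eventually_elim (use ab(2) in \<open>auto intro!: less_imp_le simp: hull_inc\<close>)
    qed
    then have "m * b \<le> a \<bullet> integral\<^sup>L \<mu> G" using int by (simp add: m_def)
    also have "\<dots> = m * (a \<bullet> c)" using m by (simp add: c_def)
    finally show False using ab(1) m by simp
  qed
  then obtain S u where S: "finite S" "S \<subseteq> G ` Y" "\<And>v. v \<in> S \<Longrightarrow> 0 \<le> u v" "(\<Sum>v\<in>S. u v *\<^sub>R v) = c"
    unfolding convex_hull_explicit by blast
  have "G (inv_into Y G v) = v" "inv_into Y G v \<in> Y" if "v \<in> S" for v
    using that S(2) by (auto intro: f_inv_into_f inv_into_into)
  moreover have "integral\<^sup>L \<mu> G = (\<Sum>v\<in>S. (m * u v) *\<^sub>R v)"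
  proof -
    have "integral\<^sup>L \<mu> G = m *\<^sub>R c" using m by (simp add: c_def)
    then show ?thesis by (simp add: scaleR_sum_right flip: S(4))
  qed
  ultimately show ?thesis
    using S m by (intro exI[of _ S] exI[of _ "\<lambda>v. m * u v"] exI[of _ "inv_into Y G"]) simp
qed


section \<open>The fractional semi-infinite program\<close>

text \<open>Both cases enter only through two properties of \<open>Cy\<close>: its members are
  nonnegative on Y, and it contains every polynomial of the degree of p in y that is nonnegative on
  Y.\<close>

locale sos_convex_program =
  fixes f g :: "'m::finite mpoly" and s :: nat and \<psi> :: "nat \<Rightarrow> 'm mpoly"
    and p :: "('m, 'n::finite) mpoly2" and Y :: "(real ^ 'n) set" and Cy :: "'n mpoly set"
    and x_star :: "real ^ 'm"
  assumes compact_Y: "compact Y"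
    and convex: "all_sos_convex f g s \<psi> p Y"
    and Cy_nonneg: "\<And>q y. q \<in> Cy \<Longrightarrow> y \<in> Y \<Longrightarrow> 0 \<le> eval q y"
    and Cy_complete: "\<And>q. deg q \<le> deg_y p \<Longrightarrow> (\<And>y. y \<in> Y \<Longrightarrow> 0 \<le> eval q y) \<Longrightarrow> q \<in> Cy"
    and A2: "A2 f g (feasible_set s \<psi> p Y)"
    and x_star: "x_star \<in> minimizers f g (feasible_set s \<psi> p Y)"
begin

abbreviation "K \<equiv> feasible_set s \<psi> p Y"
abbreviation "d \<equiv> max_deg f g s \<psi> p"
abbreviation "r \<equiv> eval f x_star / eval g x_star"

lemma deg_le_d: "deg f \<le> d" "deg g \<le> d" "j \<in> {1..s} \<Longrightarrow> deg (\<psi> j) \<le> d" "deg_x p \<le> d"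
  unfolding max_deg_def by (rule Max_ge, simp, blast)+

lemma deg_at_y_le: "deg (at_y p y) \<le> d"
  unfolding at_y_def using deg_apply_y_le deg_le_d(4) by (rule order_trans)

lemma convexD: "sos_convex f" "sos_convex (- g)" "j \<in> {1..s} \<Longrightarrow> sos_convex (\<psi> j)"
  "y \<in> Y \<Longrightarrow> sos_convex (at_y p y)"
  using convex by (auto simp: all_sos_convex_def)

lemma g_pos: "x \<in> K \<Longrightarrow> 0 < eval g x"
  using A2 by (auto simp: A2_def)

lemma x_star_in_K: "x_star \<in> K" and r_le: "x \<in> K \<Longrightarrow> r \<le> eval f x / eval g x"
  using x_star by (auto simp: minimizers_def)

lemma min_value_eq: "min_value f g K = r"
  unfolding min_value_def using x_star_in_K r_le by (intro Least_equality) auto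

section \<open>Dual feasible functionals and points\<close>

lemma dual_feasible_eval:
  assumes "x \<in> K"
  shows "(\<lambda>h. eval h x / eval g x) \<in> dual_feasible g s \<psi> p (cone_x d) Cy"
proof -
  define L where "L h = eval h x / eval g x" for h
  have gx: "0 < eval g x" using assms by (rule g_pos)
  have lin: "linear L"
    by (rule linearI) (simp_all add: L_def eval_simps add_divide_distrib)
  have "- apply_x L p \<in> Cy"
  proof (rule Cy_complete)
    show "deg (- apply_x L p) \<le> deg_y p" by (simp add: deg_apply_x_le)
    show "0 \<le> eval (- apply_x L p) y" if "y \<in> Y" for y
      using that assms gx
      by (simp add: eval_minus eval_apply_x[OF lin] L_def feasible_set_def divide_le_0_iff)
  qed
  moreover have "L \<in> dual_cone (cone_x d)"
    using gx lin by (auto simp: dual_cone_def cone_x_def L_def sos_eval_nonneg)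
  moreover have "L (\<psi> j) \<le> 0" if "j \<in> {1..s}" for j
    using that assms gx by (auto simp: L_def feasible_set_def divide_le_0_iff)
  moreover have "L g = 1" using gx by (simp add: L_def)
  ultimately show ?thesis unfolding dual_feasible_def L_def[abs_def] by blast
qed

text \<open>If \<open>L 1 = 0\<close>, then \<open>L ((1 + t g)\<^sup>2) \<ge> 0\<close> for all \<open>t\<close> forces \<open>L g = 0\<close>.\<close>

lemma dual_feasible_mass_pos:
  assumes "L \<in> dual_feasible g s \<psi> p (cone_x d) Cy" shows "0 < L 1"
proof (rule ccontr)
  assume neg: "\<not> 0 < L 1"
  have lin: "linear L" and L: "\<And>h. h \<in> sos \<Longrightarrow> deg h \<le> 2 * d \<Longrightarrow> 0 \<le> L h" and Lg: "L g = 1"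
    using assms by (auto simp: dual_feasible_def dual_cone_def cone_x_def)
  have deg: "deg ((1 + t *\<^sub>R g)\<^sup>2) \<le> 2 * d" for t
    using deg_le_d(2) by (intro deg_power_le deg_add_le deg_scaleR_le) (simp flip: single_one)
  have "0 \<le> L 1" using L[OF sos_square deg[of 0]] by simp
  then have L1: "L 1 = 0" using neg by simp
  define b where "b = L (g\<^sup>2)"
  \<comment> \<open>A negative t so small that |t b| is at most 1; then 2t + t^2 b = t (2 + t b) is
    negative.\<close>
  define t where "t = - 1 / (\<bar>b\<bar> + 1)"
  have "0 \<le> L ((1 + t *\<^sub>R g)\<^sup>2)" by (rule L[OF sos_square deg])
  also have "(1 + t *\<^sub>R g)\<^sup>2 = 1 + (2 * t) *\<^sub>R g + t\<^sup>2 *\<^sub>R g\<^sup>2"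
    by (rule eval_inject) (simp add: eval_simps power2_eq_square algebra_simps)
  also have "L \<dots> = 2 * t + t\<^sup>2 * b"
    by (simp add: linear_add[OF lin] linear_cmul[OF lin] L1 Lg b_def)
  finally have "0 \<le> t * (2 + t * b)" by (simp add: power2_eq_square algebra_simps)
  moreover have "t < 0" by (simp add: t_def add_pos_nonneg)
  moreover have "0 < 2 + t * b"
  proof -
    have "\<bar>t * b\<bar> \<le> 1" by (simp add: t_def abs_mult)
    then show ?thesis by linarith
  qed
  ultimately show False by (simp add: zero_le_mult_iff)
qed

lemma dual_feasible_point:
  assumes "L \<in> dual_feasible g s \<psi> p (cone_x d) Cy"
  defines "a \<equiv> \<chi> i. L (variable i) / L 1"
  shows "a \<in> K" "eval f a / eval g a \<le> L f"
proof -
  have L: "L \<in> dual_cone (cone_x d)" "linear L" "L g = 1" "- apply_x L p \<in> Cy"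
    "\<And>j. j \<in> {1..s} \<Longrightarrow> L (\<psi> j) \<le> 0"
    using assms(1) by (auto simp: dual_feasible_def dual_cone_def)
  have L1: "0 < L 1" using assms(1) by (rule dual_feasible_mass_pos)
  have jensen: "L 1 * eval h a \<le> L h" if "sos_convex h" "deg h \<le> d" for h
    unfolding a_def using that by (intro jensen_sos_convex[OF L(1) L1]) auto
  show aK: "a \<in> K"
    unfolding feasible_set_def
  proof (intro CollectI conjI ballI)
    fix j assume j: "j \<in> {1..s}"
    then have "L 1 * eval (\<psi> j) a \<le> 0"
      using jensen[OF convexD(3)[OF j] deg_le_d(3)[OF j]] L(5)[OF j] by linarith
    then show "eval (\<psi> j) a \<le> 0" using L1 by (simp add: mult_le_0_iff)
  next
    fix y assume y: "y \<in> Y"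
    have "L 1 * eval (at_y p y) a \<le> 0"
      using jensen[OF convexD(4)[OF y] deg_at_y_le] Cy_nonneg[OF L(4) y]
      by (simp add: eval_minus eval_apply_x[OF L(2)])
    then show "eval (at_y p y) a \<le> 0" using L1 by (simp add: mult_le_0_iff)
  qed
  have ga: "0 < eval g a" using aK by (rule g_pos)
  have f: "L 1 * eval f a \<le> L f" using convexD(1) deg_le_d(1) by (rule jensen)
  have "L 1 * eval (- g) a \<le> L (- g)" using convexD(2) deg_le_d(2) by (intro jensen) simp_all
  then have g: "1 \<le> L 1 * eval g a" by (simp add: eval_minus linear_neg[OF L(2)] L(3))
  show "eval f a / eval g a \<le> L f"
  \<comment> \<open>For f(a) nonnegative the bound \<open>1 / eval g a \<le> L 1\<close> suffices.
    For f(a) negative the reverse bound on \<open>L 1\<close> is needed as well, and there (A2)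
    makes g affine.\<close>
  proof (cases "0 \<le> eval f a")
    case True
    have "1 / eval g a \<le> L 1" using g ga by (simp add: divide_le_eq)
    from mult_right_mono[OF this True] f show ?thesis by simp
  next
    case False
    then have "affine_poly g" using A2 aK by (auto simp: A2_def)
    then have "L 1 * eval g a \<le> 1"
      using jensen[OF affine_sos_convex deg_le_d(2)] L(3) by (simp add: affine_poly_def)
    with g ga have "L 1 = 1 / eval g a" by (simp add: field_simps)
    with f show ?thesis by simp
  qed
qed

lemma r_le_dual: "L \<in> dual_feasible g s \<psi> p (cone_x d) Cy \<Longrightarrow> r \<le> L f"
  using dual_feasible_point r_le by (meson order_trans)

text \<open>Weak duality, by evaluating the certificate at \<open>x_star\<close>: all terms besides
  f - \<rho> g are nonpositive there. For the H-term, -p(x_star, y) is nonnegative on Y and so lies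
  in \<open>Cy\<close>.\<close>

lemma primal_feasible_le:
  assumes "(\<rho>, H, \<eta>) \<in> primal_feasible f g s \<psi> p (cone_x d) Cy"
  shows "\<rho> \<le> r"
proof -
  have H: "linear H" "\<And>q. q \<in> Cy \<Longrightarrow> 0 \<le> H q" and \<eta>: "\<And>j. j \<in> {1..s} \<Longrightarrow> 0 \<le> \<eta> j"
    and sos: "f - \<rho> *\<^sub>R g + apply_y H p + (\<Sum>j=1..s. \<eta> j *\<^sub>R \<psi> j) \<in> sos"
    using assms by (auto simp: primal_feasible_def dual_cone_def cone_x_def)
  have "0 \<le> eval f x_star - \<rho> * eval g x_star + eval (apply_y H p) x_star + (\<Sum>j=1..s. \<eta> j * eval (\<psi> j) x_star)"
    using sos_eval_nonneg[OF sos, of x_star] by (simp add: eval_simps)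
  moreover have "(\<Sum>j=1..s. \<eta> j * eval (\<psi> j) x_star) \<le> 0"
    using x_star_in_K \<eta> by (intro sum_nonpos mult_nonneg_nonpos) (auto simp: feasible_set_def)
  moreover have "eval (apply_y H p) x_star \<le> 0"
  proof -
    let ?q = "apply_x (\<lambda>h. eval h x_star) p"
    have "- ?q \<in> Cy"
    proof (rule Cy_complete)
      show "deg (- ?q) \<le> deg_y p" by (simp add: deg_apply_x_le)
      show "0 \<le> eval (- ?q) y" if "y \<in> Y" for y
        using that x_star_in_K by (simp add: eval_minus eval_apply_x[OF linear_eval] feasible_set_def)
    qed
    then show ?thesis
      using H(2)[of "- ?q"] by (simp add: apply_swap[OF linear_eval H(1)] linear_neg[OF H(1)])
  qed
  ultimately have "\<rho> * eval g x_star \<le> eval f x_star" by linarith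
  then show ?thesis using g_pos[OF x_star_in_K] by (simp add: pos_le_divide_eq)
qed

text \<open>The measure in (A3) lives on the constraints active at the minimizer \<open>x_star\<close>, and replacing it by
  finitely many atoms with the same gradient at \<open>x_star\<close> keeps the Lagrangian stationary there. The new
  Lagrangian then equals its own Taylor remainder at \<open>x_star\<close>, hence is a sum of squares.\<close>

lemma primal_attained:
  assumes "A3 f g s \<psi> p Y r"
  shows "\<exists>H \<eta>. (r, H, \<eta>) \<in> primal_feasible f g s \<psi> p (cone_x d) Cy"
proof -
  obtain \<mu> \<eta> where \<mu>: "finite_measure \<mu>" "sets \<mu> = sets borel" "emeasure \<mu> (- Y) = 0"
    and \<eta>: "\<forall>j\<in>{1..s}. 0 \<le> \<eta> j"
    and inf: "(INF x\<in>UNIV. ereal (eval f x - r * eval g x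
            + (LINT y:Y|\<mu>. eval (at_y p y) x) + (\<Sum>j=1..s. \<eta> j * eval (\<psi> j) x))) = 0"
    using assms unfolding A3_def by blast
  have space: "space \<mu> = UNIV" using sets_eq_imp_space_eq[OF \<mu>(2)] by simp
  have Y_sets: "Y \<in> sets \<mu>" using compact_imp_closed[OF compact_Y] by (simp add: \<mu>(2))
  have AE_Y: "AE y in \<mu>. y \<in> Y"
    by (rule AE_I[of _ _ "- Y"])
      (use \<mu>(3) sets.compl_sets[OF Y_sets] space in \<open>auto simp: Compl_eq_Diff_UNIV\<close>)
  have integrable: "integrable \<mu> (eval q)" for q
    using \<mu>(1,2) compact_Y AE_Y continuous_on_eval by (rule AE_compact_integrable)
  define Hm where "Hm q = integral\<^sup>L \<mu> (eval q)" for q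
  have lin_Hm: "linear Hm"
  proof (rule linearI)
    show "Hm (a + b) = Hm a + Hm b" for a b
      using Bochner_Integration.integral_add[OF integrable[of a] integrable[of b]]
      by (simp add: Hm_def eval_add[abs_def])
    show "Hm (c *\<^sub>R a) = c *\<^sub>R Hm a" for a c
      by (simp add: Hm_def eval_scaleR[abs_def])
  qed
  have lin_D: "linear (\<lambda>h. eval (partial_deriv i h) x_star)" for i
    by (rule linearI) (simp_all add: partial_deriv_add partial_deriv_scaleR eval_simps)
  have Hm_p: "eval (apply_y Hm p) x = (LINT y:Y|\<mu>. eval (at_y p y) x)" for x
  proof -
    have at_y_eq: "(\<lambda>y. eval (at_y p y) x) = eval (apply_x (\<lambda>h. eval h x) p)"
      by (simp add: fun_eq_iff eval_apply_x[OF linear_eval])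
    have "eval (apply_y Hm p) x = integral\<^sup>L \<mu> (\<lambda>y. eval (at_y p y) x)"
      unfolding at_y_eq using apply_swap[OF linear_eval[of x] lin_Hm, of p] by (simp add: Hm_def)
    also have "\<dots> = (LINT y:Y|\<mu>. eval (at_y p y) x)"
      unfolding set_lebesgue_integral_def
    proof (rule integral_cong_AE)
      have m: "(\<lambda>y. eval (at_y p y) x) \<in> borel_measurable \<mu>"
        unfolding at_y_eq by (rule borel_measurable_integrable[OF integrable])
      then show "(\<lambda>y. eval (at_y p y) x) \<in> borel_measurable \<mu>" .
      show "(\<lambda>y. indicat_real Y y *\<^sub>R eval (at_y p y) x) \<in> borel_measurable \<mu>"
        using m Y_sets by simp
      show "AE y in \<mu>. eval (at_y p y) x = indicat_real Y y *\<^sub>R eval (at_y p y) x"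
        using AE_Y by eventually_elim simp
    qed
    finally show ?thesis .
  qed
  define h where "h = f - r *\<^sub>R g + apply_y Hm p + (\<Sum>j=1..s. \<eta> j *\<^sub>R \<psi> j)"
  have h_nonneg: "0 \<le> eval h x" for x
  proof -
    have "0 \<le> ereal (eval f x - r * eval g x
            + (LINT y:Y|\<mu>. eval (at_y p y) x) + (\<Sum>j=1..s. \<eta> j * eval (\<psi> j) x))"
      unfolding inf[symmetric] by (rule INF_lower) simp
    then show ?thesis by (simp add: h_def eval_simps Hm_p)
  qed
  have gxs: "0 < eval g x_star" using x_star_in_K by (rule g_pos)
  have p_nonpos: "eval (at_y p y) x_star \<le> 0" if "y \<in> Y" for y
    using x_star_in_K that by (simp add: feasible_set_def)
  have psi_nonpos: "(\<Sum>j=1..s. \<eta> j * eval (\<psi> j) x_star) \<le> 0"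
    using x_star_in_K \<eta> by (intro sum_nonpos mult_nonneg_nonpos) (auto simp: feasible_set_def)
  let ?P = "apply_x (\<lambda>h. eval h x_star) p"
  have eval_P: "eval ?P y = eval (at_y p y) x_star" for y by (rule eval_apply_x[OF linear_eval])
  have Hm_P: "eval (apply_y Hm p) x_star = integral\<^sup>L \<mu> (eval ?P)"
    using apply_swap[OF linear_eval lin_Hm] by (simp add: Hm_def)
  have AE_P: "AE y in \<mu>. 0 \<le> - eval ?P y"
    using AE_Y by eventually_elim (simp add: eval_P p_nonpos)
  have "0 \<le> integral\<^sup>L \<mu> (\<lambda>y. - eval ?P y)" using AE_P by (rule integral_nonneg_AE)
  then have Hm_nonpos: "integral\<^sup>L \<mu> (eval ?P) \<le> 0" by simp
  \<comment> \<open>Complementary slackness: f - r g vanishes at \<open>x_star\<close>, so the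
    nonnegative value of h there is a sum of two nonpositive terms, and both are zero.\<close>
  have h_xs: "eval h x_star = integral\<^sup>L \<mu> (eval ?P) + (\<Sum>j=1..s. \<eta> j * eval (\<psi> j) x_star)"
    using gxs by (simp add: h_def eval_simps Hm_P)
  then have zero: "integral\<^sup>L \<mu> (eval ?P) = 0" "(\<Sum>j=1..s. \<eta> j * eval (\<psi> j) x_star) = 0" "eval h x_star = 0"
    using h_nonneg[of x_star] Hm_nonpos psi_nonpos by auto
  have grad_h: "eval (partial_deriv i h) x_star = 0" for i
  proof -
    have "((\<lambda>t. eval h (x_star + t *\<^sub>R axis i 1)) has_real_derivative
        (\<Sum>j\<in>UNIV. eval (partial_deriv j h) (x_star + 0 *\<^sub>R axis i 1) * axis i 1 $ j)) (at 0)"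
      by (rule DERIV_eval_line)
    then have "(\<Sum>j\<in>UNIV. eval (partial_deriv j h) (x_star + 0 *\<^sub>R axis i 1) * axis i 1 $ j) = 0"
      by (rule DERIV_local_min[of _ _ _ 1]) (simp_all add: zero(3) h_nonneg)
    then show ?thesis by (simp add: axis_def if_distrib cong: if_cong)
  qed
  \<comment> \<open>Using \<open>Y0\<close> rather than Y as the compact carrier of \<mu> makes
    every atom active, so the new Lagrangian still vanishes at \<open>x_star\<close>.\<close>
  define Y0 where "Y0 = {y\<in>Y. eval ?P y = 0}"
  have "compact (Y \<inter> {y. eval ?P y = 0})"
    by (intro compact_Int_closed compact_Y closed_Collect_eq continuous_on_eval continuous_intros)
  then have compact_Y0: "compact Y0" by (simp add: Y0_def Collect_conj_eq)
  have "AE y in \<mu>. - eval ?P y = 0"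
    using integral_nonneg_eq_0_iff_AE[of \<mu> "\<lambda>y. - eval ?P y"] AE_P integrable[of ?P] zero(1) by simp
  with AE_Y have AE_Y0: "AE y in \<mu>. y \<in> Y0"
    by eventually_elim (simp add: Y0_def)
  define G where "G y = gradient (at_y p y) x_star" for y
  have G_i: "G y $ i = eval (apply_x (\<lambda>h. eval (partial_deriv i h) x_star) p) y" for y i
    by (simp add: G_def gradient_def eval_apply_x[OF lin_D])
  have cont_G: "continuous_on UNIV G"
  proof (subst continuous_on_componentwise, rule ballI)
    fix b :: "real ^ 'm" assume "b \<in> Basis"
    then obtain i where b: "b = axis i 1" by (auto simp: Basis_vec_def)
    have "(\<lambda>y. G y \<bullet> b) = eval (apply_x (\<lambda>h. eval (partial_deriv i h) x_star) p)"
      by (simp add: fun_eq_iff b inner_axis G_i)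
    then show "continuous_on UNIV (\<lambda>y. G y \<bullet> b)" by (simp only: continuous_on_eval)
  qed
  obtain S :: "(real ^ 'm) set" and w z where S: "finite S" "\<forall>v\<in>S. 0 \<le> w v \<and> z v \<in> Y0"
    and int_G: "integral\<^sup>L \<mu> G = (\<Sum>v\<in>S. w v *\<^sub>R G (z v))"
    using integral_in_convex_cone[OF \<mu>(1,2) compact_Y0 AE_Y0 cont_G] by blast
  have int_G_i: "(\<Sum>v\<in>S. w v * G (z v) $ i) = Hm (apply_x (\<lambda>h. eval (partial_deriv i h) x_star) p)" for i
  proof -
    have "integrable \<mu> G" using \<mu>(1,2) compact_Y0 AE_Y0 cont_G by (rule AE_compact_integrable)
    then have "integral\<^sup>L \<mu> G $ i = integral\<^sup>L \<mu> (\<lambda>y. G y $ i)"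
      using integral_inner_left[of "axis i 1" \<mu> G] by (simp add: inner_axis)
    then show ?thesis by (simp add: int_G G_i Hm_def)
  qed
  define H where "H q = (\<Sum>v\<in>S. w v * eval q (z v))" for q
  have H_p: "apply_y H p = (\<Sum>v\<in>S. w v *\<^sub>R at_y p (z v))"
    unfolding H_def[abs_def] by (rule apply_y_atomic)
  define N where "N = f - r *\<^sub>R g + apply_y H p + (\<Sum>j=1..s. \<eta> j *\<^sub>R \<psi> j)"
  have "eval N x_star = 0"
  proof -
    have "eval (at_y p (z v)) x_star = 0" if "v \<in> S" for v
      using S(2) that by (simp add: Y0_def eval_P)
    then show ?thesis using gxs zero(2) by (simp add: N_def H_p eval_simps)
  qed
  moreover have "eval (partial_deriv i N) x_star = 0" for i
  proof -
    note D = linear_add[OF lin_D] linear_diff[OF lin_D]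
    have "eval (partial_deriv i (apply_y H p)) x_star = (\<Sum>v\<in>S. w v * G (z v) $ i)"
      by (simp add: H_p linear_sum[OF lin_D] linear_cmul[OF lin_D] G_def gradient_def)
    \<comment> \<open>Differentiating under the integral is an exchange of two linear functionals on
      a polynomial.\<close>
    also have "\<dots> = eval (partial_deriv i (apply_y Hm p)) x_star"
      unfolding int_G_i by (rule apply_swap[OF lin_D lin_Hm, symmetric])
    finally show ?thesis using grad_h[of i] by (simp add: N_def h_def D)
  qed
  ultimately have "N = taylor_remainder x_star N" by (simp add: taylor_remainder_def)
  also have "\<dots> = taylor_remainder x_star f + (- r) *\<^sub>R taylor_remainder x_star g +
      (\<Sum>v\<in>S. w v *\<^sub>R taylor_remainder x_star (at_y p (z v))) +
      (\<Sum>j=1..s. \<eta> j *\<^sub>R taylor_remainder x_star (\<psi> j))"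
    by (simp add: N_def H_p linear_add[OF linear_taylor_remainder] linear_diff[OF linear_taylor_remainder]
        linear_sum[OF linear_taylor_remainder] linear_cmul[OF linear_taylor_remainder])
  also have "\<dots> \<in> sos"
  proof (intro sos_add sos_sum)
    show "taylor_remainder x_star f \<in> sos" using convexD(1) by (rule taylor_remainder_sos)
    \<comment> \<open>For r nonnegative, -r g is a nonnegative multiple of the s.o.s-convex -g. For
      r negative, f(x_star) is negative, so (A2) makes g affine and hence s.o.s-convex.\<close>
    show "(- r) *\<^sub>R taylor_remainder x_star g \<in> sos"
    proof (cases "0 \<le> r")
      case True
      have "r *\<^sub>R taylor_remainder x_star (- g) \<in> sos"
        using True convexD(2) by (intro sos_scaleR taylor_remainder_sos)
      then show ?thesis by (simp add: linear_neg[OF linear_taylor_remainder])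
    next
      case False
      then have "\<not> 0 \<le> eval f x_star" using gxs by (auto simp: divide_less_0_iff)
      then have "affine_poly g" using A2 x_star_in_K by (auto simp: A2_def)
      then show ?thesis
        using False by (intro sos_scaleR taylor_remainder_sos affine_sos_convex) (auto simp: affine_poly_def)
    qed
    show "w v *\<^sub>R taylor_remainder x_star (at_y p (z v)) \<in> sos" if "v \<in> S" for v
      using S(2) that convexD(4) by (intro sos_scaleR taylor_remainder_sos) (auto simp: Y0_def)
    show "\<eta> j *\<^sub>R taylor_remainder x_star (\<psi> j) \<in> sos" if "j \<in> {1..s}" for j
      using \<eta> that convexD(3)[OF that] by (intro sos_scaleR taylor_remainder_sos) auto
  qed
  finally have "N \<in> sos" .
  moreover have "deg N \<le> 2 * d"
  proof -
    have "deg N \<le> d"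
      unfolding N_def using deg_le_d order_trans[OF deg_apply_y_le deg_le_d(4)]
      by (intro deg_add_le deg_diff_le deg_scaleR_le deg_sum_le) auto
    then show ?thesis by simp
  qed
  moreover have "H \<in> dual_cone Cy"
  proof -
    have "linear H"
      unfolding H_def by (rule linearI) (simp_all add: eval_simps algebra_simps sum.distrib sum_distrib_left)
    moreover have "0 \<le> H q" if "q \<in> Cy" for q
      unfolding H_def using S(2) Cy_nonneg[OF that] by (intro sum_nonneg mult_nonneg_nonneg) (auto simp: Y0_def)
    ultimately show ?thesis by (simp add: dual_cone_def)
  qed
  ultimately have "(r, H, \<eta>) \<in> primal_feasible f g s \<psi> p (cone_x d) Cy"
    using \<eta> by (simp add: primal_feasible_def cone_x_def N_def)
  then show ?thesis by blast
qed

section \<open>Optimal values and attainment\<close>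

theorem dual_solution:
  shows "\<exists>L. dual_minimizer f g s \<psi> p (cone_x d) Cy L"
    and "dual_value f g s \<psi> p (cone_x d) Cy = ereal r"
    and "dual_minimizer f g s \<psi> p (cone_x d) Cy L \<Longrightarrow>
      L 1 \<noteq> 0 \<and> (\<chi> i. L (variable i) / L 1) \<in> minimizers f g K"
proof -
  define L0 where "L0 = (\<lambda>h. eval h x_star / eval g x_star)"
  have L0: "L0 \<in> dual_feasible g s \<psi> p (cone_x d) Cy" "L0 f = r"
    using dual_feasible_eval[OF x_star_in_K] by (simp_all add: L0_def)
  show "\<exists>L. dual_minimizer f g s \<psi> p (cone_x d) Cy L"
    using L0 r_le_dual unfolding dual_minimizer_def by auto
  show "dual_value f g s \<psi> p (cone_x d) Cy = ereal r"
    unfolding dual_value_def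
    by (rule antisym) (auto intro!: INF_lower2[OF L0(1)] INF_greatest simp: L0(2) r_le_dual)
  assume L: "dual_minimizer f g s \<psi> p (cone_x d) Cy L"
  then have feas: "L \<in> dual_feasible g s \<psi> p (cone_x d) Cy" and "L f \<le> r"
    using L0 by (auto simp: dual_minimizer_def)
  then have "eval f (\<chi> i. L (variable i) / L 1) / eval g (\<chi> i. L (variable i) / L 1) \<le> r"
    using dual_feasible_point(2)[OF feas] by linarith
  then have "(\<chi> i. L (variable i) / L 1) \<in> minimizers f g K"
    using dual_feasible_point(1)[OF feas] r_le unfolding minimizers_def by (auto intro: order_trans)
  with dual_feasible_mass_pos[OF feas] show "L 1 \<noteq> 0 \<and> (\<chi> i. L (variable i) / L 1) \<in> minimizers f g K"
    by simp
qed

theorem primal_solution: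
  assumes "A3 f g s \<psi> p Y r"
  shows "primal_value f g s \<psi> p (cone_x d) Cy = ereal r"
    and "\<exists>(\<rho>, H, \<eta>) \<in> primal_feasible f g s \<psi> p (cone_x d) Cy.
      ereal \<rho> = primal_value f g s \<psi> p (cone_x d) Cy"
proof -
  obtain H \<eta> where H: "(r, H, \<eta>) \<in> primal_feasible f g s \<psi> p (cone_x d) Cy"
    using primal_attained[OF assms] by blast
  show *: "primal_value f g s \<psi> p (cone_x d) Cy = ereal r"
    unfolding primal_value_def
    by (rule antisym) (auto intro!: SUP_least SUP_upper2[OF H] primal_feasible_le)
  show "\<exists>(\<rho>, H, \<eta>) \<in> primal_feasible f g s \<psi> p (cone_x d) Cy.
      ereal \<rho> = primal_value f g s \<psi> p (cone_x d) Cy"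
    unfolding * using H by force
qed

end

section \<open>The interval and the quadratic cone as instances\<close>

lemma cone_y_interval_nonneg:
  fixes q :: "'n::finite mpoly"
  assumes "q \<in> cone_y_interval dy" "\<And>i. y $ i \<in> {-1..1}"
  shows "0 \<le> eval q y"
proof -
  obtain \<sigma> \<tau> where "q = \<sigma> + \<tau> * (1 - variable (the_elem (UNIV :: 'n set)) ^ 2)" "\<sigma> \<in> sos" "\<tau> \<in> sos"
    using assms(1) by (auto simp: cone_y_interval_def Let_def)
  moreover have "(y $ the_elem (UNIV :: 'n set))\<^sup>2 \<le> 1"
    using assms(2)[of "the_elem UNIV"] by (simp add: abs_square_le_1 abs_le_iff)
  ultimately show ?thesis by (simp add: eval_simps sos_eval_nonneg)
qed

lemma cone_y_quadratic_nonneg: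
  assumes "q \<in> cone_y_quadratic \<phi>" "0 \<le> eval \<phi> y"
  shows "0 \<le> eval q y"
  using assms by (auto simp: cone_y_quadratic_def eval_simps sos_eval_nonneg)

theorem theorem5p2:
  fixes f g :: "'m::finite mpoly"
    and s :: nat and \<psi> :: "nat \<Rightarrow> 'm mpoly"
    and p :: "('m, 'n::finite) mpoly2"
    and Y :: "(real ^ 'n) set" and K :: "(real ^ 'm) set" and r_star :: real
    and Cx :: "'m mpoly set" and Cy :: "'n mpoly set"
  assumes "compact Y"
    and "K = feasible_set s \<psi> p Y"
    and "r_star = min_value f g K"
    and "minimizers f g K \<noteq> {}"
    and "Cx = cone_x (max_deg f g s \<psi> p)"
    and "(case1 f g s \<psi> p Y \<and> Cy = cone_y_interval (deg_y p)) \<or>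
         (\<exists>\<phi>. case2 f g s \<psi> p Y \<phi> \<and> Cy = cone_y_quadratic \<phi>)"
    and "A2 f g K"
  shows "((\<exists>L. dual_minimizer f g s \<psi> p Cx Cy L) \<and>
          dual_value f g s \<psi> p Cx Cy = ereal r_star \<and>
          (\<forall>L. dual_minimizer f g s \<psi> p Cx Cy L \<longrightarrow>
             L 1 \<noteq> 0 \<and> (\<chi> i. L (variable i) / L 1) \<in> minimizers f g K)) \<and>
         (A3 f g s \<psi> p Y r_star \<longrightarrow>
          primal_value f g s \<psi> p Cx Cy = ereal r_star \<and>
          (\<exists>(\<rho>, H, \<eta>) \<in> primal_feasible f g s \<psi> p Cx Cy.
             ereal \<rho> = primal_value f g s \<psi> p Cx Cy))"
proof -
  obtain x0 where x0: "x0 \<in> minimizers f g K" using assms(4) by blast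
  \<comment> \<open>In Case 2, \<open>deg_y p = 2\<close> meets the degree bound of the quadratic
    cone, and compactness of Y is that of the superlevel set of \<phi>.\<close>
  have cones: "(\<forall>q\<in>Cy. \<forall>y\<in>Y. 0 \<le> eval q y) \<and>
      (\<forall>q. deg q \<le> deg_y p \<longrightarrow> (\<forall>y\<in>Y. 0 \<le> eval q y) \<longrightarrow> q \<in> Cy) \<and> all_sos_convex f g s \<psi> p Y"
    using assms(6)
  proof
    assume 1: "case1 f g s \<psi> p Y \<and> Cy = cone_y_interval (deg_y p)"
    have "0 \<le> eval q y" if "q \<in> Cy" "y \<in> Y" for q y
      using 1 that by (intro cone_y_interval_nonneg[of q "deg_y p"]) (simp_all add: case1_def)
    with 1 show ?thesis
      by (auto simp: case1_def intro!: nonneg_in_cone_y_interval)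
  next
    assume "\<exists>\<phi>. case2 f g s \<psi> p Y \<phi> \<and> Cy = cone_y_quadratic \<phi>"
    then obtain \<phi> y0 where \<phi>: "Y = {y. 0 \<le> eval \<phi> y}" "deg \<phi> = 2" "0 < eval \<phi> y0" "deg_y p = 2"
      "all_sos_convex f g s \<psi> p Y" "Cy = cone_y_quadratic \<phi>"
      by (auto simp: case2_def)
    then show ?thesis
      using nonneg_in_cone_y_quadratic[of \<phi> y0] assms(1) by (auto intro: cone_y_quadratic_nonneg)
  qed
  interpret sos_convex_program f g s \<psi> p Y Cy x0
    using cones assms(1,2,7) x0 by unfold_locales auto
  show ?thesis
    using dual_solution primal_solution unfolding assms(2,3,5) min_value_eq by blast
qed

end
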